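(* Let $k \geq d \geq 3$ and $n \geq \frac{dk}{d-1}$. Suppose that $\mathcal{F}$ is a family of $k$-element subsets of $[n]=\{1,\ldots,n\}$ such that every $(d,\frac{d+1}{2})$-cluster is intersecting, i.e., for any $A_1,A_2,\ldots,A_d\in\mathcal{F}$, $|A_1\cup A_2\cup\cdots\cup A_d|\leq \frac{d+1}{2}k$ implies $A_1\cap A_2\cap\cdots\cap A_d\neq\emptyset$. Then $|\mathcal{F}|\leq \binom{n-1}{k-1}$, with equality only when $\mathcal{F}$ is a complete star.
   Context: A family $\mathcal{F}$ of $k$-subsets of a set $X$ is a complete star if there is $x\in X$ such that $\mathcal{F}$ consists of all $k$-subsets of $X$ containing $x$. *)

theory Defs
  imports Complex_Main "HOL-Library.Ramsey"
begin

text \<open>A \<open>(d, c)\<close>-cluster of \<open>k\<close>-sets is a family of \<open>d\<close> pairwise distinct \<open>k\<close>-sets whose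
  union has at most \<open>c k\<close> elements; distinctness holds because the family is a set of
  cardinality \<open>d\<close>.\<close>

definition is_cluster :: "nat \<Rightarrow> real \<Rightarrow> nat \<Rightarrow> 'a set set \<Rightarrow> bool" where
  "is_cluster d c k \<C> \<longleftrightarrow>
     \<C> \<in> nsets (nsets UNIV k) d \<and> real (card (\<Union>\<C>)) \<le> c * real k"

definition complete_star :: "'a set \<Rightarrow> nat \<Rightarrow> 'a set set \<Rightarrow> bool" where
  "complete_star X k \<F> \<longleftrightarrow> (\<exists>x\<in>X. \<F> = {A \<in> nsets X k. x \<in> A})"

end

theory Submission imports Defs "HOL-Combinatorics.Multiset_Permutations" begin

text \<open>
  For \<open>|X| > 2k\<close>, either every member has few neighbours (members meeting it in at
  least \<open>k/2\<close> points), and then each member has two \<open>(k-1)\<close>-subsets lying in no other member; or some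
  \<open>S\<close> has enough neighbours to pad triples \<open>S, A, B\<close> to clusters, so that \<open>|S \<union> A \<union> B| \<le> 2k\<close>
  forces \<open>S \<inter> A \<inter> B \<noteq> {}\<close>. In the second case, group the members meeting \<open>S\<close> by their part
  \<open>Z\<close> outside \<open>S\<close>. For fixed \<open>Z\<close> of size at least \<open>k/2\<close> their traces on \<open>S\<close> form an intersecting
  family, and for \<open>|Z| + |Z'| = k\<close> no trace for \<open>Z\<close> is complementary to one for \<open>Z'\<close>; by Vandermonde's
  identity this gives the bound for the members meeting \<open>S\<close>. A set \<open>Z\<close> contained in a member
  disjoint from \<open>S\<close> contributes nothing, and the members disjoint from \<open>S\<close> are at most as many as the
  \<open>(k-1)\<close>-sets they contain, so their presence only lowers the total.

  For \<open>|X| \<le> 2k\<close> the family is \<open>d\<close>-wise intersecting, and Katona's averaging over cyclic orders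
  applies: complements of members do not cover \<open>X\<close> by \<open>d\<close> sets, so every cyclic order has at least
  \<open>l = |X| - k\<close> arcs of length \<open>l\<close> that are not complements of members. Equality makes these \<open>l\<close>-sets
  an extremal intersecting family, hence a star if \<open>|X| < 2k\<close>; for \<open>|X| = 2k\<close> a smallest intersection
  of two members is contained in every member.
\<close>

section \<open>Shadows\<close>

definition shadow :: "'a set set \<Rightarrow> nat \<Rightarrow> 'a set set" where
  "shadow H j = (\<Union>A\<in>H. nsets A j)"

text \<open>Gaussian elimination by induction on the equations \<open>B\<close>: equation
  \<open>b\<close> eliminates the unknown \<open>a0\<close> from the others, and the value of
  \<open>a0\<close> is afterwards recovered from \<open>b\<close>.\<close>

lemma underdetermined_system:
  fixes M :: "'a \<Rightarrow> 'b \<Rightarrow> real"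
  assumes "finite B" "finite A" "card B < card A"
  shows "\<exists>u. (\<exists>a\<in>A. u a \<noteq> 0) \<and> (\<forall>b\<in>B. (\<Sum>a\<in>A. u a * M a b) = 0)"
  using assms
proof (induction B arbitrary: A M rule: finite_induct)
  case empty
  then obtain a where "a \<in> A" by fastforce
  then show ?case by (intro exI[of _ "\<lambda>_. 1"]) auto
next
  case (insert b B)
  show ?case
  proof (cases "\<forall>a\<in>A. M a b = 0")
    case True
    with insert.IH[of A M] insert.prems insert.hyps show ?thesis by auto
  next
    case False
    then obtain a0 where a0: "a0 \<in> A" "M a0 b \<noteq> 0" by blast
    let ?M = "\<lambda>a c. M a c - M a b / M a0 b * M a0 c"
    have "card B < card (A - {a0})"
      using insert.prems insert.hyps a0 by simp
    from insert.IH[OF _ this, of ?M] insert.prems obtain v where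
      v: "\<exists>a\<in>A - {a0}. v a \<noteq> 0" "\<forall>c\<in>B. (\<Sum>a\<in>A - {a0}. v a * ?M a c) = 0" by auto
    define t where "t = - (\<Sum>a\<in>A - {a0}. v a * M a b) / M a0 b"
    define u where "u = v(a0 := t)"
    have u_sum: "(\<Sum>a\<in>A. u a * M a c) = t * M a0 c + (\<Sum>a\<in>A - {a0}. v a * M a c)" for c
    proof -
      have "(\<Sum>a\<in>A. u a * M a c) = u a0 * M a0 c + (\<Sum>a\<in>A - {a0}. u a * M a c)"
        using a0 insert.prems by (simp add: sum.remove)
      also have "(\<Sum>a\<in>A - {a0}. u a * M a c) = (\<Sum>a\<in>A - {a0}. v a * M a c)"
        by (intro sum.cong) (auto simp: u_def)
      finally show ?thesis by (simp add: u_def)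
    qed
    have "(\<Sum>a\<in>A. u a * M a c) = 0" if "c \<in> insert b B" for c
    proof (cases "c = b")
      case True
      then show ?thesis using a0 by (simp add: u_sum t_def)
    next
      case False
      then have "c \<in> B" using that by simp
      then have "0 = (\<Sum>a\<in>A - {a0}. v a * ?M a c)" using v(2) by simp
      also have "\<dots> = (\<Sum>a\<in>A - {a0}. v a * M a c) - (\<Sum>a\<in>A - {a0}. v a * M a b) / M a0 b * M a0 c"
        by (simp add: right_diff_distrib sum_subtractf sum_distrib_right sum_divide_distrib mult.assoc)
      finally show ?thesis by (simp add: u_sum t_def)
    qed
    moreover have "\<exists>a\<in>A. u a \<noteq> 0" using v(1) by (auto simp: u_def)
    ultimately show ?thesis by blast
  qed
qed

text \<open>If the family were larger than its shadow, some nonzero weighting of it would have vanishing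
  sums over the members above each \<open>(k-1)\<close>-set, hence above each smaller set. By
  inclusion-exclusion, the weight of a member \<open>S\<close> is then, up to sign, the total weight of the
  members with trace \<open>U\<close> on \<open>S\<close>, for every proper subset \<open>U\<close> of \<open>S\<close>; a missing trace makes
  it zero.\<close>

lemma card_le_card_shadow:
  assumes fin: "finite H" and unif: "\<And>A. A \<in> H \<Longrightarrow> finite A \<and> card A = k"
    and miss: "\<And>S. S \<in> H \<Longrightarrow> \<exists>U. U \<subset> S \<and> (\<forall>A\<in>H. A \<inter> S \<noteq> U)"
  shows "card H \<le> card (shadow H (k - 1))"
proof (rule ccontr)
  assume "\<not> ?thesis"
  then have less: "card (shadow H (k - 1)) < card H" by simp
  have finS: "finite (shadow H (k - 1))"
    unfolding shadow_def using fin unif by (auto intro: finite_imp_finite_nsets)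
  from underdetermined_system[OF finS fin less, of "\<lambda>A T. of_bool (T \<subseteq> A)"]
  obtain u :: "'a set \<Rightarrow> real" where u: "\<exists>A\<in>H. u A \<noteq> 0"
    and u0: "\<And>T. T \<in> shadow H (k - 1) \<Longrightarrow> (\<Sum>A\<in>H. u A * of_bool (T \<subseteq> A)) = 0" by auto
  \<comment> \<open>A \<open>(k - 1)\<close>-set outside the shadow lies in no member, so its sum is
    empty and the condition holds for all \<open>(k - 1)\<close>-sets.\<close>
  have top: "(\<Sum>A\<in>{A\<in>H. T \<subseteq> A}. u A) = 0" if "finite T" "card T = k - 1" for T
  proof (cases "T \<in> shadow H (k - 1)")
    case True
    have "(\<Sum>A\<in>{A\<in>H. T \<subseteq> A}. u A) = (\<Sum>A\<in>H. u A * of_bool (T \<subseteq> A))"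
      using fin by (intro sum.mono_neutral_cong_left) auto
    with u0[OF True] show ?thesis by simp
  next
    case False
    then have "{A\<in>H. T \<subseteq> A} = {}" using that by (auto simp: shadow_def nsets_def)
    then show ?thesis by (metis sum.empty)
  qed
  have low: "(\<Sum>A\<in>{A\<in>H. J \<subseteq> A}. u A) = 0" if "finite J" "card J < k" for J
    using that
  proof (induction "k - 1 - card J" arbitrary: J)
    case 0
    then show ?case using top[of J] by simp
  next
    case (Suc r)
    let ?X = "\<Union>H - J"
    have finX: "finite ?X" using fin unif by auto
    \<comment> \<open>Double count of pairs of a point \<open>x\<close> outside \<open>J\<close> and
      a member above \<open>insert x J\<close>: each member above \<open>J\<close> occurs
      \<open>k - card J\<close> times, a nonzero factor.\<close>
    have "(\<Sum>x\<in>?X. \<Sum>A\<in>{A\<in>H. insert x J \<subseteq> A}. u A) = 0"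
    proof (rule sum.neutral, rule ballI)
      fix x assume x: "x \<in> ?X"
      then have c: "card (insert x J) = Suc (card J)" using Suc.prems by simp
      show "(\<Sum>A\<in>{A\<in>H. insert x J \<subseteq> A}. u A) = 0"
        using c Suc.hyps(2) Suc.prems by (intro Suc.hyps(1)) auto
    qed
    also have "(\<Sum>x\<in>?X. \<Sum>A\<in>{A\<in>H. insert x J \<subseteq> A}. u A) =
        (\<Sum>x\<in>?X. \<Sum>A\<in>{A\<in>{A\<in>H. J \<subseteq> A}. x \<in> A}. u A)"
      by (intro sum.cong) auto
    also have "\<dots> = (\<Sum>A\<in>{A\<in>H. J \<subseteq> A}. \<Sum>x\<in>{x\<in>?X. x \<in> A}. u A)"
      using fin finX by (intro sum.swap_restrict) auto
    also have "\<dots> = (\<Sum>A\<in>{A\<in>H. J \<subseteq> A}. real (k - card J) * u A)"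
    proof (intro sum.cong refl)
      fix A assume "A \<in> {A\<in>H. J \<subseteq> A}"
      then have A: "A \<in> H" "J \<subseteq> A" by auto
      then have "{x\<in>?X. x \<in> A} = A - J" by auto
      then show "(\<Sum>x\<in>{x\<in>?X. x \<in> A}. u A) = real (k - card J) * u A"
        using A unif[of A] Suc.prems by (simp add: card_Diff_subset)
    qed
    also have "\<dots> = real (k - card J) * (\<Sum>A\<in>{A\<in>H. J \<subseteq> A}. u A)"
      by (simp add: sum_distrib_left)
    finally show ?case using Suc.prems by simp
  qed
  have "u S = 0" if S: "S \<in> H" for S
  proof -
    \<comment> \<open>Inclusion-exclusion by induction on the avoided set \<open>W\<close>: avoiding
      one more point \<open>w\<close> subtracts the members above \<open>insert w J\<close>, and the
      sum before subtraction vanishes because \<open>J \<union> W\<close> still lacks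
      \<open>w\<close>.\<close>
    have trace: "(\<Sum>A\<in>{A\<in>H. J \<subseteq> A \<and> A \<inter> W = {}}. u A) = (if J \<union> W = S then (-1) ^ card W * u S else 0)"
      if "finite W" "J \<inter> W = {}" "J \<union> W \<subseteq> S" for J W
      using that
    proof (induction W arbitrary: J rule: finite_induct)
      case empty
      show ?case
      proof (cases "J = S")
        case True
        have "A = S" if "A \<in> H" "S \<subseteq> A" for A
          using card_subset_eq[of A S] unif that S by metis
        then have "{A\<in>H. J \<subseteq> A \<and> A \<inter> {} = {}} = {S}"
          using S True by auto
        then show ?thesis using True by simp
      next
        case False
        with empty have "J \<subset> S" by auto
        then have "card J < k" "finite J"
          using unif[OF S] by (metis psubset_card_mono, meson finite_subset psubset_imp_subset)
        then show ?thesis using low[of J] False by simp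
      qed
    next
      case (insert w W)
      have "{A\<in>H. J \<subseteq> A \<and> A \<inter> W = {}} =
          {A\<in>H. J \<subseteq> A \<and> A \<inter> insert w W = {}} \<union> {A\<in>H. insert w J \<subseteq> A \<and> A \<inter> W = {}}" by auto
      then have "(\<Sum>A\<in>{A\<in>H. J \<subseteq> A \<and> A \<inter> W = {}}. u A) =
          (\<Sum>A\<in>{A\<in>H. J \<subseteq> A \<and> A \<inter> insert w W = {}}. u A) + (\<Sum>A\<in>{A\<in>H. insert w J \<subseteq> A \<and> A \<inter> W = {}}. u A)"
        using fin by (simp only:) (intro sum.union_disjoint, auto)
      moreover have "(\<Sum>A\<in>{A\<in>H. J \<subseteq> A \<and> A \<inter> W = {}}. u A) = 0"
      proof -
        have "J \<union> W \<noteq> S" using insert by auto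
        then show ?thesis using insert.IH[of J] insert.prems by auto
      qed
      moreover have "(\<Sum>A\<in>{A\<in>H. insert w J \<subseteq> A \<and> A \<inter> W = {}}. u A) =
          (if insert w J \<union> W = S then (-1) ^ card W * u S else 0)"
        using insert by (intro insert.IH) auto
      moreover have "insert w J \<union> W = J \<union> insert w W" by simp
      ultimately show ?case using insert.hyps
        by (cases "J \<union> insert w W = S") (simp_all del: Un_insert_right Un_insert_left)
    qed
    obtain U where U: "U \<subset> S" "\<forall>A\<in>H. A \<inter> S \<noteq> U" using miss[OF S] by blast
    have none: "{A\<in>H. U \<subseteq> A \<and> A \<inter> (S - U) = {}} = {}" using U by blast
    have "(-1) ^ card (S - U) * u S = 0"
      using trace[of "S - U" U] U unif[OF S] unfolding none by (auto split: if_splits)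
    then show ?thesis by simp
  qed
  with u show False by blast
qed

section \<open>Arcs of cyclic orders\<close>

text \<open>Starts beyond one turn are allowed, so that arcs can be compared inside any window of
  \<open>length xs\<close> consecutive positions.\<close>

definition arc :: "'a list \<Rightarrow> nat \<Rightarrow> nat \<Rightarrow> 'a set" where
  "arc xs l p = (\<lambda>i. xs ! (i mod length xs)) ` {p..<p + l}"

lemma inj_on_mod_window: "inj_on (\<lambda>i. i mod n) {p..<p + n}" for n :: nat
proof (rule inj_onI)
  fix i j assume *: "i \<in> {p..<p + n}" "j \<in> {p..<p + n}" "i mod n = j mod n"
  have "i = j" if "i \<le> j" "i mod n = j mod n" "j < i + n" for i j :: nat
  proof -
    have "n dvd j - i" using that by (metis mod_eq_dvd_iff_nat)
    moreover have "j - i < n" using that by linarith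
    ultimately show ?thesis using that by (auto dest: nat_dvd_not_less)
  qed
  from this[of i j] this[of j i] * show "i = j"
    by (metis atLeastLessThan_iff add_le_mono1 linorder_le_cases order_less_le_trans)
qed

lemma mod_window_image: "0 < n \<Longrightarrow> (\<lambda>i. i mod n) ` {p..<p + n} = {..<n}" for n :: nat
  by (rule card_subset_eq) (auto simp: card_image inj_on_mod_window)

lemma card_filter_mod_window:
  fixes n :: nat
  assumes "0 < n"
  shows "card {q\<in>{p..<p + n}. P (q mod n)} = card {q\<in>{..<n}. P q}"
proof -
  have "(\<lambda>i. i mod n) ` {q\<in>{p..<p + n}. P (q mod n)} = {q\<in>{..<n}. P q}"
    unfolding mod_window_image[OF assms, of p, symmetric] by blast
  moreover have "inj_on (\<lambda>i. i mod n) {q\<in>{p..<p + n}. P (q mod n)}"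
    by (rule inj_on_subset[OF inj_on_mod_window]) auto
  ultimately show ?thesis by (metis card_image)
qed

lemma arc_window_inj:
  assumes "distinct xs"
  shows "inj_on (\<lambda>i. xs ! (i mod length xs)) {p..<p + length xs}"
proof (cases "xs = []")
  case False
  then have "inj_on ((!) xs \<circ> (\<lambda>i. i mod length xs)) {p..<p + length xs}"
    using assms by (intro comp_inj_on inj_on_mod_window)
      (simp add: mod_window_image inj_on_nth)
  then show ?thesis by (simp add: comp_def)
qed simp

lemma arc_subset: "xs \<noteq> [] \<Longrightarrow> arc xs l p \<subseteq> set xs"
  by (auto simp: arc_def)

lemma card_arc: "distinct xs \<Longrightarrow> l \<le> length xs \<Longrightarrow> card (arc xs l p) = l"
  unfolding arc_def by (subst card_image[OF inj_on_subset[OF arc_window_inj[of xs p]]]) auto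

lemma arc_full: "distinct xs \<Longrightarrow> arc xs (length xs) p = set xs"
proof (cases "xs = []")
  case False
  then show "distinct xs \<Longrightarrow> ?thesis"
    by (intro card_subset_eq arc_subset) (simp_all add: card_arc distinct_card)
qed (simp add: arc_def)

lemma arc_in_nsets:
  "xs \<in> permutations_of_set X \<Longrightarrow> X \<noteq> {} \<Longrightarrow> l \<le> card X \<Longrightarrow> arc xs l p \<in> nsets X l"
  using arc_subset[of xs l p] card_arc[of xs l p]
  by (auto simp: nsets_def permutations_of_set_def distinct_card arc_def)

lemma arc_mod: "arc xs l (p mod length xs) = arc xs l p"
proof -
  have "(\<lambda>i. xs ! ((i + r) mod length xs)) ` {0..<l} = arc xs l r" for r
    unfolding arc_def by (subst image_image[symmetric, where g = "\<lambda>i. i + r"], subst image_add_atLeastLessThan') (simp add: add.commute)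
  from this[of p] this[of "p mod length xs"] show ?thesis
    by (simp add: mod_add_right_eq)
qed

lemma arc_add_length: "arc xs l (p + length xs) = arc xs l p"
  by (metis arc_mod mod_add_self2)

lemma arc_disjoint:
  assumes "distinct xs" "p + l \<le> q" "q + m \<le> p + length xs"
  shows "arc xs l p \<inter> arc xs m q = {}"
proof -
  have "arc xs l p \<inter> arc xs m q =
      (\<lambda>i. xs ! (i mod length xs)) ` ({p..<p + l} \<inter> {q..<q + m})"
    unfolding arc_def using assms by (intro inj_on_image_Int[OF arc_window_inj[of xs p], symmetric]) auto
  then show ?thesis using assms by auto
qed

lemma image_add_lessThan: "(\<lambda>i. i + r) ` {..<s} = {r..<r + s}" for r s :: nat
  unfolding atLeast0LessThan[symmetric] image_add_atLeastLessThan' by (simp add: add.commute)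

text \<open>The arc begins with \<open>cs\<close> and wraps round through \<open>as\<close>; it
  realises a set split between the two ends of a list.\<close>

lemma arc_append:
  "arc (as @ bs @ cs) (length as + length cs) (length as + length bs) = set as \<union> set cs"
proof -
  let ?xs = "as @ bs @ cs" let ?m = "length as + length bs" and ?n = "length (as @ bs @ cs)"
  have split: "{?m..<?m + (length as + length cs)} = (\<lambda>i. i + ?m) ` {..<length cs} \<union> (\<lambda>i. i + ?n) ` {..<length as}"
    unfolding image_add_lessThan by auto
  have "?xs ! ((i + ?m) mod ?n) = cs ! i" if "i < length cs" for i
  proof -
    have "(i + ?m) mod ?n = length as + (length bs + i)" using that by (intro mod_less[THEN trans]) auto
    then show ?thesis by (simp only: nth_append_length_plus)
  qed
  then have "(\<lambda>i. ?xs ! (i mod ?n)) ` (\<lambda>i. i + ?m) ` {..<length cs} = (!) cs ` {..<length cs}"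
    unfolding image_image by (intro image_cong) auto
  moreover have "?xs ! ((i + ?n) mod ?n) = as ! i" if "i < length as" for i
  proof -
    have "(i + ?n) mod ?n = i" using that by (subst mod_add_self2, intro mod_less) auto
    then show ?thesis using that by (simp only: nth_append if_True)
  qed
  then have "(\<lambda>i. ?xs ! (i mod ?n)) ` (\<lambda>i. i + ?n) ` {..<length as} = (!) as ` {..<length as}"
    unfolding image_image by (intro image_cong) auto
  moreover have "(!) cs ` {..<length cs} = set cs" "(!) as ` {..<length as} = set as"
    by (auto simp: set_conv_nth)
  ultimately show ?thesis
    unfolding arc_def split image_Un by auto
qed

lemma arc_append_middle: "arc (as @ bs @ cs) (length bs) (length as) = set bs"
proof -
  have "(as @ bs @ cs) ! ((i + length as) mod length (as @ bs @ cs)) = bs ! i" if "i < length bs" for i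
  proof -
    have "(i + length as) mod length (as @ bs @ cs) = length as + i" using that by (intro mod_less[THEN trans]) auto
    then show ?thesis using that by (metis nth_append_length_plus nth_append)
  qed
  then have "(\<lambda>i. (as @ bs @ cs) ! (i mod length (as @ bs @ cs))) ` (\<lambda>i. i + length as) ` {..<length bs}
      = (!) bs ` {..<length bs}"
    unfolding image_image by (intro image_cong) auto
  then show ?thesis by (auto simp: arc_def set_conv_nth image_add_lessThan)
qed

text \<open>A permutation of \<open>X\<close> carrying one \<open>l\<close>-set to another maps the
  orders with the first as arc at \<open>p\<close> into those with the second, so every
  \<open>l\<close>-set is this arc equally often.\<close>

lemma card_arc_in:
  assumes X: "finite X" "X \<noteq> {}" and G: "G \<subseteq> nsets X l" and l: "l \<le> card X"
  shows "card {xs\<in>permutations_of_set X. arc xs l p \<in> G} * (card X choose l) = card G * fact (card X)"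
proof -
  define c where "c A = card {xs\<in>permutations_of_set X. arc xs l p = A}" for A
  have le: "c A \<le> c B" if AB: "A \<in> nsets X l" "B \<in> nsets X l" for A B
  proof -
    have "card A = card B" "card (X - A) = card (X - B)" "finite A" "finite B"
      using AB X by (auto simp: nsets_def card_Diff_subset)
    then obtain f g where f: "bij_betw f A B" and g: "bij_betw g (X - A) (X - B)"
      using X by (meson finite_Diff finite_same_card_bij)
    define \<sigma> where "\<sigma> x = (if x \<in> A then f x else if x \<in> X then g x else x)" for x
    have "bij_betw \<sigma> A B" "bij_betw \<sigma> (X - A) (X - B)"
      using f g bij_betw_cong[of A \<sigma> f B] bij_betw_cong[of "X - A" \<sigma> g "X - B"]
      by (simp_all add: \<sigma>_def)
    then have "bij_betw \<sigma> (A \<union> (X - A)) (B \<union> (X - B))" by (rule bij_betw_combine) auto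
    then have "bij_betw \<sigma> X X" using AB by (simp add: nsets_def Un_absorb1)
    then have perm: "\<sigma> permutes X" by (rule bij_imp_permutes) (use AB in \<open>auto simp: \<sigma>_def nsets_def\<close>)
    have im: "\<sigma> ` A = B" using \<open>bij_betw \<sigma> A B\<close> by (simp add: bij_betw_def)
    have "inj (map \<sigma>)" using permutes_inj[OF perm] by simp
    moreover have "map \<sigma> ` {xs\<in>permutations_of_set X. arc xs l p = A} \<subseteq> {xs\<in>permutations_of_set X. arc xs l p = B}"
    proof (intro subsetI, elim imageE, clarify, intro conjI)
      fix xs assume xs: "xs \<in> permutations_of_set X" "A = arc xs l p"
      show "map \<sigma> xs \<in> permutations_of_set X" using xs permutations_of_set_image_permutes[OF perm] by blast
      have "xs \<noteq> []" using xs X by (auto simp: permutations_of_set_def)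
      then have "arc (map \<sigma> xs) l p = \<sigma> ` arc xs l p"
        unfolding arc_def image_image by (intro image_cong) auto
      then show "arc (map \<sigma> xs) l p = B" using im xs by simp
    qed
    ultimately show ?thesis
      unfolding c_def by (intro card_inj_on_le[of "map \<sigma>"]) (auto intro: inj_on_subset)
  qed
  then have eq: "c A = c B" if "A \<in> nsets X l" "B \<in> nsets X l" for A B
    using that by (meson le_antisym)
  have fib: "card {xs\<in>permutations_of_set X. arc xs l p \<in> K} = (\<Sum>A\<in>K. c A)" if K: "K \<subseteq> nsets X l" for K
  proof -
    have "finite K" using K X by (meson finite_imp_finite_nsets finite_subset)
    moreover have "{xs\<in>permutations_of_set X. arc xs l p \<in> K} = (\<Union>A\<in>K. {xs\<in>permutations_of_set X. arc xs l p = A})"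
      by auto
    ultimately show ?thesis unfolding c_def by (simp only:) (rule card_UN_disjoint, auto)
  qed
  obtain A0 where A0: "A0 \<in> nsets X l"
    using l X by (metis nsets_eq_empty_iff ex_in_conv leD)
  have "card {xs\<in>permutations_of_set X. arc xs l p \<in> G} = card G * c A0"
    using fib[OF G] eq[OF _ A0] G by (simp add: subset_iff)
  moreover have "fact (card X) = (card X choose l) * c A0"
  proof -
    have "{xs\<in>permutations_of_set X. arc xs l p \<in> nsets X l} = permutations_of_set X"
      using arc_in_nsets X l by auto
    then show ?thesis using fib[of "nsets X l"] eq[OF _ A0] X by simp
  qed
  ultimately show ?thesis by simp
qed

section \<open>Averaging over all orders\<close>

definition arc_count :: "'a set set \<Rightarrow> nat \<Rightarrow> 'a list \<Rightarrow> nat" where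
  "arc_count N l xs = card {p\<in>{..<length xs}. arc xs l p \<in> N}"

lemma sum_arc_count:
  assumes X: "finite X" "X \<noteq> {}" and N: "N \<subseteq> nsets X l" and l: "l \<le> card X"
  shows "(\<Sum>xs\<in>permutations_of_set X. arc_count N l xs) * (card X choose l) = card X * card N * fact (card X)"
proof -
  have "(\<Sum>xs\<in>permutations_of_set X. arc_count N l xs) =
      (\<Sum>xs\<in>permutations_of_set X. \<Sum>p\<in>{p\<in>{..<card X}. arc xs l p \<in> N}. 1)"
    by (intro sum.cong) (auto simp: arc_count_def length_finite_permutations_of_set)
  also have "\<dots> = (\<Sum>p<card X. \<Sum>xs\<in>{xs\<in>permutations_of_set X. arc xs l p \<in> N}. 1)"
    by (rule sum.swap_restrict) auto
  finally show ?thesis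
    using card_arc_in[OF X N l] by (simp add: sum_distrib_right)
qed

text \<open>The average of \<open>arc_count\<close> is
  \<open>card X * card N / (card X choose l)\<close>, and absorption turns this into the bound. At
  equality the average is the minimum \<open>l\<close>, so no order exceeds it.\<close>

lemma card_ge_of_arc_count:
  assumes X: "finite X" and N: "N \<subseteq> nsets X l" and l: "0 < l" "l \<le> card X"
    and ge: "\<And>xs. xs \<in> permutations_of_set X \<Longrightarrow> l \<le> arc_count N l xs"
  shows "(card X - 1) choose (l - 1) \<le> card N"
    and "card N = (card X - 1) choose (l - 1) \<Longrightarrow> xs \<in> permutations_of_set X \<Longrightarrow> arc_count N l xs = l"
proof -
  let ?n = "card X" and ?P = "permutations_of_set X"
  have X0: "X \<noteq> {}" using l by auto
  have bin: "l * (?n choose l) = ?n * ((?n - 1) choose (l - 1))"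
    using l by (intro times_binomial_minus1_eq) auto
  have pos: "0 < ?n choose l" using l by simp
  have sum_l: "(\<Sum>xs\<in>?P. l) = l * fact ?n" using X by simp
  have "l * fact ?n \<le> (\<Sum>xs\<in>?P. arc_count N l xs)"
    unfolding sum_l[symmetric] by (rule sum_mono) (rule ge)
  then have "l * fact ?n * (?n choose l) \<le> ?n * card N * fact ?n"
    unfolding sum_arc_count[OF X X0 N l(2), symmetric] by simp
  then have "fact ?n * (?n * ((?n - 1) choose (l - 1))) \<le> fact ?n * (?n * card N)"
    unfolding bin[symmetric] by (simp add: mult_ac)
  then show "(?n - 1) choose (l - 1) \<le> card N" using l by simp
  assume eq: "card N = (?n - 1) choose (l - 1)" and xs: "xs \<in> ?P"
  have "(\<Sum>xs\<in>?P. arc_count N l xs) * (?n choose l) = l * fact ?n * (?n choose l)"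
    unfolding sum_arc_count[OF X X0 N l(2)] eq using bin by (simp add: mult_ac)
  then have sum_eq: "(\<Sum>xs\<in>?P. arc_count N l xs) = (\<Sum>xs\<in>?P. l)" using pos sum_l by (metis mult_right_cancel less_not_refl)
  show "arc_count N l xs = l"
  proof (rule ccontr)
    assume "arc_count N l xs \<noteq> l"
    with ge[OF xs] have "l < arc_count N l xs" by simp
    then have "(\<Sum>xs\<in>?P. l) < (\<Sum>xs\<in>?P. arc_count N l xs)"
      using xs ge by (intro sum_strict_mono_ex1) auto
    with sum_eq show False by simp
  qed
qed

section \<open>Families of \<open>l\<close>-sets whose non-members admit no small cover\<close>

lemma enumeration_exists:
  assumes "finite X" "A \<subseteq> X" "B \<subseteq> X" "A \<inter> B = {}"
  obtains as bs cs where "set as = A" "set bs = B" "set cs = X - A - B" "distinct as" "distinct bs" "distinct cs"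
    "as @ bs @ cs \<in> permutations_of_set X"
proof -
  have "finite A" "finite B" "finite (X - A - B)" using assms by (auto intro: finite_subset)
  then obtain as bs cs where *: "set as = A" "distinct as" "set bs = B" "distinct bs" "set cs = X - A - B" "distinct cs"
    by (meson finite_distinct_list)
  with assms that[of as bs cs] show ?thesis by (auto simp: permutations_of_set_def)
qed

text \<open>\<open>cov\<close> is \<open>d\<close>-wise intersection read through complements, and
  \<open>card X \<le> d * l\<close> says that \<open>d\<close> arcs of length \<open>l\<close> can
  go all the way round.\<close>

locale no_cover =
  fixes X :: "'a set" and l d :: nat and N :: "'a set set"
  assumes fin: "finite X" and l: "0 < l" "l < card X" and d: "card X \<le> d * l"
    and N: "N \<subseteq> nsets X l"
    and cov: "\<And>\<W>. \<W> \<subseteq> nsets X l - N \<Longrightarrow> card \<W> \<le> d \<Longrightarrow> \<Union>\<W> \<noteq> X"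
begin

lemma X_ne: "X \<noteq> {}"
  using l by auto

lemma arc_in: "xs \<in> permutations_of_set X \<Longrightarrow> arc xs l p \<in> nsets X l"
  using arc_in_nsets X_ne l by (metis less_imp_le)

text \<open>The arcs outside \<open>N\<close> starting at \<open>p0\<close> and at the positions congruent to \<open>p0 + a\<close>, possibly
  without the first one, cover the cycle with at most \<open>d\<close> arcs.\<close>

lemma arc_in_residue_class:
  assumes xs: "xs \<in> permutations_of_set X" and p0: "arc xs l p0 \<notin> N" and a: "0 < a" "a \<le> l"
  shows "\<exists>q. p0 < q \<and> q < p0 + card X \<and> (q - p0) mod l = a mod l \<and> arc xs l q \<in> N"
proof (rule ccontr)
  assume none: "\<not> ?thesis"
  let ?n = "card X"
  have len: "length xs = ?n" "distinct xs" "set xs = X"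
    using xs by (auto simp: length_finite_permutations_of_set permutations_of_set_def)
  have out: "arc xs l (p0 + (a + j * l)) \<in> nsets X l - N" if "a + j * l < ?n" for j
  proof -
    have "p0 < p0 + (a + j * l)" "p0 + (a + j * l) < p0 + ?n" "(p0 + (a + j * l) - p0) mod l = a mod l"
      using a that by auto
    then have "arc xs l (p0 + (a + j * l)) \<notin> N" using none by blast
    with arc_in[OF xs] show ?thesis by blast
  qed
  have elem: "x \<in> X \<longleftrightarrow> (\<exists>t\<in>{r..<r + ?n}. x = xs ! (t mod ?n))" for r x
    using arc_full[OF len(2), of r] len unfolding arc_def by auto
  have in_arc: "xs ! ((p0 + t) mod ?n) \<in> arc xs l (p0 + (a + (t - a) div l * l))" if "a \<le> t" for t
  proof -
    have "a + (t - a) div l * l \<le> t" "t < a + (t - a) div l * l + l"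
      using that l(1) div_mult_mod_eq[of "t - a" l] mod_less_divisor[OF l(1), of "t - a"] by linarith+
    then show ?thesis using len by (auto simp: arc_def)
  qed
  \<comment> \<open>If \<open>d\<close> of the starts fit in one turn, their arcs alone reach round
    the cycle. Otherwise at most \<open>d - 1\<close> fit, which leaves room for the arc at
    \<open>p0\<close>; it fills the gap before \<open>a\<close> because
    \<open>a \<le> l\<close>.\<close>
  show False
  proof (cases "a + (d - 1) * l < ?n")
    case True
    let ?W = "(\<lambda>j. arc xs l (p0 + (a + j * l))) ` {..<d}"
    have "a + j * l < ?n" if "j < d" for j
    proof -
      have "j * l \<le> (d - 1) * l" using that by (intro mult_le_mono1) simp
      with True show ?thesis by linarith
    qed
    then have sub: "?W \<subseteq> nsets X l - N" using out by auto
    have "X \<subseteq> \<Union>?W"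
    proof
      fix x assume "x \<in> X"
      then obtain t' where t': "t' \<in> {p0 + a..<p0 + a + ?n}" "x = xs ! (t' mod ?n)" using elem by blast
      define t where "t = t' - p0"
      have t: "a \<le> t" "t < a + ?n" "t' = p0 + t" using t' by (auto simp: t_def)
      have "t - a < d * l" using t d by linarith
      then have "(t - a) div l < d" by (simp add: less_mult_imp_div_less)
      with in_arc[OF t(1)] t' t(3) show "x \<in> \<Union>?W" by blast
    qed
    moreover have "\<Union>?W \<subseteq> X" using sub by (auto simp: nsets_def)
    moreover have "card ?W \<le> d" using card_image_le[of "{..<d}"] by (metis card_lessThan finite_lessThan)
    ultimately show False using cov[OF sub] by blast
  next
    case False
    let ?J = "{j. a + j * l < ?n}"
    let ?W = "insert (arc xs l p0) ((\<lambda>j. arc xs l (p0 + (a + j * l))) ` ?J)"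
    have J: "?J \<subseteq> {..<d - 1}"
    proof
      fix j assume j: "j \<in> ?J"
      show "j \<in> {..<d - 1}"
      proof (rule ccontr)
        assume "j \<notin> {..<d - 1}"
        then have "(d - 1) * l \<le> j * l" by (intro mult_le_mono1) simp
        with j False show False by simp
      qed
    qed
    have d0: "0 < d" using d l by (cases d) auto
    have sub: "?W \<subseteq> nsets X l - N" using out p0 arc_in[OF xs] by auto
    have "card ((\<lambda>j. arc xs l (p0 + (a + j * l))) ` ?J) \<le> d - 1"
      using card_image_le[of ?J "\<lambda>j. arc xs l (p0 + (a + j * l))"] card_mono[OF _ J] finite_subset[OF J] by simp
    then have "card ?W \<le> d" using d0 by (intro card_insert_le_m1)
    moreover have "X \<subseteq> \<Union>?W"
    proof
      fix x assume "x \<in> X"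
      then obtain t' where t': "t' \<in> {p0..<p0 + ?n}" "x = xs ! (t' mod ?n)" using elem by blast
      define t where "t = t' - p0"
      have t: "t < ?n" "t' = p0 + t" using t' by (auto simp: t_def)
      show "x \<in> \<Union>?W"
      proof (cases "t < l")
        case True
        then have "x \<in> arc xs l p0" using t t' len by (auto simp: arc_def)
        then show ?thesis by blast
      next
        case False
        then have at: "a \<le> t" using a by simp
        have "a + (t - a) div l * l < ?n"
          using at t div_times_less_eq_dividend[of "t - a" l] by linarith
        with in_arc[OF at] t' t(2) show ?thesis by blast
      qed
    qed
    moreover have "\<Union>?W \<subseteq> X" using sub by (auto simp: nsets_def)
    ultimately show False using cov[OF sub] by blast
  qed
qed

lemma residues_of_arcs:
  assumes xs: "xs \<in> permutations_of_set X" and p0: "arc xs l p0 \<notin> N"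
  shows "(\<lambda>q. (q - p0) mod l) ` {q\<in>{p0..<p0 + card X}. arc xs l q \<in> N} = {..<l}" (is "?f ` ?Q = _")
proof
  show "?f ` ?Q \<subseteq> {..<l}" using l by auto
  show "{..<l} \<subseteq> ?f ` ?Q"
  proof
    fix r assume r: "r \<in> {..<l}"
    \<comment> \<open>Residue \<open>0\<close> is represented by \<open>a = l\<close>, since the
      offset has to be positive.\<close>
    define a where "a = (if r = 0 then l else r)"
    have a: "0 < a" "a \<le> l" "a mod l = r" using r l by (auto simp: a_def)
    obtain q where "p0 < q" "q < p0 + card X" "(q - p0) mod l = a mod l" "arc xs l q \<in> N"
      using arc_in_residue_class[OF xs p0 a(1,2)] by blast
    with a(3) show "r \<in> ?f ` ?Q" by (intro image_eqI[of _ _ q]) auto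
  qed
qed

lemma arc_count_window:
  assumes "xs \<in> permutations_of_set X"
  shows "card {q\<in>{p0..<p0 + card X}. arc xs l q \<in> N} = arc_count N l xs"
proof -
  have len: "length xs = card X" using assms by (simp add: length_finite_permutations_of_set)
  have "card {q\<in>{p0..<p0 + card X}. arc xs l (q mod card X) \<in> N} = card {q\<in>{..<card X}. arc xs l q \<in> N}"
    using l by (intro card_filter_mod_window) simp
  then show ?thesis using arc_mod[of xs l] len by (simp add: arc_count_def)
qed

lemma arc_count_ge:
  assumes xs: "xs \<in> permutations_of_set X"
  shows "l \<le> arc_count N l xs"
proof (cases "\<exists>p0. arc xs l p0 \<notin> N")
  case True
  then obtain p0 where p0: "arc xs l p0 \<notin> N" by blast
  have "card {..<l} \<le> card {q\<in>{p0..<p0 + card X}. arc xs l q \<in> N}"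
    unfolding residues_of_arcs[OF xs p0, symmetric] by (rule card_image_le) simp
  then show ?thesis unfolding arc_count_window[OF xs] by simp
next
  case False
  then show ?thesis using l xs by (simp add: arc_count_def length_finite_permutations_of_set)
qed

lemma card_ge: "(card X - 1) choose (l - 1) \<le> card N"
  by (rule card_ge_of_arc_count(1)[OF fin N]) (use l arc_count_ge in auto)

context
  assumes eq: "card N = (card X - 1) choose (l - 1)" and half: "2 * l \<le> card X"
begin

lemma arc_count_eq: "xs \<in> permutations_of_set X \<Longrightarrow> arc_count N l xs = l"
  by (rule card_ge_of_arc_count(2)[OF fin N]) (use l arc_count_ge eq in auto)

text \<open>Two disjoint members, laid out as consecutive arcs, lie in one residue class modulo \<open>l\<close>
  as seen from a suitable arc outside \<open>N\<close>.\<close>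

lemma N_intersecting:
  assumes AB: "A \<in> N" "B \<in> N"
  shows "A \<inter> B \<noteq> {}"
proof
  assume disj: "A \<inter> B = {}"
  have sub: "A \<subseteq> X" "B \<subseteq> X" and cardAB: "card A = l" "card B = l" using AB N by (auto simp: nsets_def)
  obtain as bs cs where *: "set as = A" "set bs = B" "distinct as" "distinct bs"
    and xs: "as @ bs @ cs \<in> permutations_of_set X"
    using enumeration_exists[OF fin sub disj] by metis
  have lens: "length as = l" "length bs = l" using * cardAB by (metis distinct_card)+
  define xs where "xs = as @ bs @ cs"
  have xs: "xs \<in> permutations_of_set X" using xs by (simp add: xs_def)
  have len: "length xs = card X" using xs by (simp add: length_finite_permutations_of_set)
  have arc0: "arc xs l 0 \<in> N" using arc_append_middle[of "[]" as "bs @ cs"] lens * AB by (simp add: xs_def)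
  have arcl: "arc xs l l \<in> N" using arc_append_middle[of as bs cs] lens * AB by (simp add: xs_def)
  \<comment> \<open>Otherwise \<open>N\<close> contains the arcs at \<open>0\<close>, at
    \<open>l\<close> and at all later positions, which are \<open>card X - l + 1 > l\<close>
    arcs.\<close>
  have "\<exists>p. l < p \<and> p < card X \<and> arc xs l p \<notin> N"
  proof (rule ccontr)
    assume "\<not> ?thesis"
    then have "{0, l} \<union> {l<..<card X} \<subseteq> {p\<in>{..<length xs}. arc xs l p \<in> N}"
      using arc0 arcl len l by auto
    then have "card ({0, l} \<union> {l<..<card X}) \<le> arc_count N l xs"
      unfolding arc_count_def by (intro card_mono) auto
    moreover have "card ({0, l} \<union> {l<..<card X}) = 2 + (card X - Suc l)"
      using l by (subst card_Un_disjoint) auto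
    ultimately show False using arc_count_eq[OF xs] half l by simp
  qed
  then obtain p where p: "l < p" "p < card X" "arc xs l p \<notin> N" by blast
  let ?Q = "{q\<in>{p..<p + card X}. arc xs l q \<in> N}" and ?f = "\<lambda>q. (q - p) mod l"
  \<comment> \<open>Exactly \<open>l\<close> positions represent \<open>l\<close> residues, so no
    residue repeats; yet the two given arcs, moved on by one turn into the window, start
    \<open>l\<close> apart.\<close>
  have "card (?f ` ?Q) = card ?Q"
    unfolding residues_of_arcs[OF xs p(3)] arc_count_window[OF xs] arc_count_eq[OF xs] by simp
  then have inj: "inj_on ?f ?Q" by (intro eq_card_imp_inj_on) auto
  have "card X \<in> ?Q" "l + card X \<in> ?Q"
    using p arc0 arcl arc_add_length[of xs l 0] arc_add_length[of xs l l] len by auto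
  moreover have "?f (card X) = ?f (l + card X)"
  proof -
    have "l + card X - p = l + (card X - p)" using p by simp
    then show ?thesis by simp
  qed
  ultimately have "card X = l + card X" using inj by (meson inj_onD)
  then show False using l by simp
qed

end

end

text \<open>Among \<open>l\<close> pairwise intersecting arcs of length \<open>l\<close> including the one at \<open>0\<close>, each of the
  \<open>l - 1\<close> pairs of disjoint arcs meeting that arc has exactly one member.\<close>

lemma intersecting_arcs_consecutive:
  assumes xs: "distinct xs" "length xs = n" and l: "0 < l" "2 * l < n"
    and inter: "\<And>A B. A \<in> N \<Longrightarrow> B \<in> N \<Longrightarrow> A \<inter> B \<noteq> {}"
    and cnt: "arc_count N l xs = l"
    and arc01: "arc xs l 0 \<in> N" "arc xs l 1 \<notin> N"
    and j: "j < l"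
  shows "arc xs l (n - j) \<in> N"
proof -
  have disj: "\<not> (arc xs l p \<in> N \<and> arc xs l q \<in> N)" if "p + l \<le> q" "q + l \<le> p + n" for p q
    using arc_disjoint[OF xs(1), of p l q l] inter that xs(2) by blast
  let ?Q = "{p\<in>{..<n}. arc xs l p \<in> N}"
  \<comment> \<open>\<open>\<phi>\<close> names the pair of disjoint arcs, at \<open>i\<close> and
    at \<open>i + n - l\<close>, to which a position belongs. No pair has two members, so
    \<open>l\<close> members fill all \<open>l\<close> pairs.\<close>
  define \<phi> where "\<phi> p = (if p < l then p else p + l - n)" for p
  have Q: "p < l \<or> n < p + l" if "p \<in> ?Q" for p
    using disj[of 0 p] that arc01 by force
  have inj: "inj_on \<phi> ?Q"
  proof (rule inj_onI)
    fix p q assume pq: "p \<in> ?Q" "q \<in> ?Q" "\<phi> p = \<phi> q"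
    have "\<not> (p < l \<and> n < q + l \<and> q + l = p + n)" if "p \<in> ?Q" "q \<in> ?Q" for p q
      using disj[of p q] that l by auto
    from this[of p q] this[of q p] show "p = q"
      using pq Q[of p] Q[of q] l by (auto simp: \<phi>_def split: if_splits)
  qed
  have "\<phi> ` ?Q \<subseteq> {..<l}" using Q l by (auto simp: \<phi>_def)
  moreover have "card (\<phi> ` ?Q) = l"
    using card_image[OF inj] cnt xs by (simp add: arc_count_def)
  ultimately have surj: "\<phi> ` ?Q = {..<l}" by (intro card_subset_eq) auto
  have alt: "arc xs l i \<in> N \<or> arc xs l (i + n - l) \<in> N" if i: "i < l" for i
  proof -
    obtain p where p: "p \<in> ?Q" "i = \<phi> p" using surj i by blast
    show ?thesis
    proof (cases "p < l")
      case False
      then have "p = i + n - l" using p Q[of p] by (auto simp: \<phi>_def)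
      then show ?thesis using p by simp
    qed (use p in \<open>simp add: \<phi>_def\<close>)
  qed
  \<comment> \<open>The arc at \<open>1\<close> is missing, so its partner is present. Each partner
    is disjoint from the next arc on the other side, as \<open>2 * l < n\<close>, and so forces the
    next partner.\<close>
  have "arc xs l (Suc i + n - l) \<in> N" if "Suc i < l" for i
    using that
  proof (induction i)
    case 0
    then show ?case using alt[of 1] arc01 by simp
  next
    case (Suc i)
    then have "arc xs l (Suc i + n - l) \<in> N" by simp
    then have "arc xs l (Suc (Suc i)) \<notin> N"
      using disj[of "Suc (Suc i)" "Suc i + n - l"] Suc.prems l by auto
    then show ?case using alt[of "Suc (Suc i)"] Suc.prems by simp
  qed
  from this[of "l - j - 1"] show ?thesis
    using j arc_add_length[of xs l 0] xs arc01 by (cases "j = 0") (auto simp: Suc_diff_Suc)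
qed

text \<open>If a member \<open>X0\<close> meets a non-member \<open>B\<close> in as many points as
  possible, exchanging a point \<open>x\<close> outside \<open>B\<close> for a point
  \<open>y\<close> of \<open>B\<close> leads out of \<open>N\<close>. Consecutive arcs then put
  every \<open>l\<close>-set with \<open>x\<close> and without \<open>y\<close> into
  \<open>N\<close>, which forces \<open>x\<close> into all members.\<close>

lemma intersecting_arcs_star:
  assumes fin: "finite X" and l: "0 < l" "2 * l < card X" and N: "N \<subseteq> nsets X l"
    and inter: "\<And>A B. A \<in> N \<Longrightarrow> B \<in> N \<Longrightarrow> A \<inter> B \<noteq> {}"
    and cnt: "\<And>xs. xs \<in> permutations_of_set X \<Longrightarrow> arc_count N l xs = l"
  shows "\<exists>x\<in>X. \<forall>E\<in>N. x \<in> E"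
proof -
  have fin_in: "finite A" "A \<subseteq> X" "card A = l" if "A \<in> nsets X l" for A using that by (auto simp: nsets_def)
  have Nne: "N \<noteq> {}"
  proof
    assume "N = {}"
    obtain xs where "xs \<in> permutations_of_set X" using fin by (metis permutations_of_set_empty_iff ex_in_conv)
    from cnt[OF this] \<open>N = {}\<close> l show False by (simp add: arc_count_def)
  qed
  then obtain A where A: "A \<in> N" by blast
  obtain B where B: "B \<in> nsets X l" "B \<notin> N"
  proof -
    have "l \<le> card (X - A)" using A N fin_in[of A] l fin by (simp add: card_Diff_subset subset_iff)
    then obtain B where "B \<subseteq> X - A" "card B = l" "finite B" by (meson obtain_subset_with_card_n)
    then have "B \<in> nsets X l" "A \<inter> B = {}" by (auto simp: nsets_def)
    then show ?thesis using inter[OF A] that by blast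
  qed
  have finN: "finite N" using N fin by (meson finite_imp_finite_nsets finite_subset)
  let ?M = "Max ((\<lambda>A. card (A \<inter> B)) ` N)"
  have "?M \<in> (\<lambda>A. card (A \<inter> B)) ` N" using finN Nne by (intro Max_in) auto
  then obtain X0 where X0: "X0 \<in> N" "card (X0 \<inter> B) = ?M" by auto
  have max: "card (A \<inter> B) \<le> card (X0 \<inter> B)" if "A \<in> N" for A
    unfolding X0(2) using finN that by (intro Max_ge) auto
  note X0' = fin_in[OF subsetD[OF N X0(1)]] and B' = fin_in[OF B(1)]
  have "\<not> X0 \<subseteq> B" "\<not> B \<subseteq> X0" using X0 B X0' B' card_subset_eq by metis+
  then obtain x y where x: "x \<in> X0" "x \<notin> B" and y: "y \<in> B" "y \<notin> X0" by blast
  define A where "A = X0 - {x}"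
  have A: "x \<notin> A" "y \<notin> A" "x \<noteq> y" "X0 = insert x A" "finite A" "card A = l - 1" "A \<subseteq> X" "x \<in> X" "y \<in> X"
    using x y X0' B' by (auto simp: A_def)
  have Ay: "insert y A \<notin> N"
  proof
    assume "insert y A \<in> N"
    from max[OF this] have "card (insert y A \<inter> B) \<le> card (X0 \<inter> B)" .
    moreover have "insert y A \<inter> B = insert y (X0 \<inter> B)" using x y by (auto simp: A_def)
    moreover have "card (insert y (X0 \<inter> B)) = Suc (card (X0 \<inter> B))" using y X0' by simp
    ultimately show False by simp
  qed
  have star: "C \<in> N" if C: "C \<in> nsets X l" "x \<in> C" "y \<notin> C" for C
  proof -
    define R where "R = X - insert x (insert y A)"
    note C' = fin_in[OF C(1)]
    have "finite R" using fin by (simp add: R_def)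
    obtain a1 a2 r1 r2 where lists:
      "set a1 = C \<inter> A" "set a2 = A - C" "set r1 = R - C" "set r2 = R \<inter> C"
      "distinct a1" "distinct a2" "distinct r1" "distinct r2"
      using \<open>finite A\<close> \<open>finite R\<close> by (metis finite_Diff finite_Int finite_distinct_list)
    \<comment> \<open>Layout: the arc at \<open>0\<close> is \<open>X0\<close>, the arc at
      \<open>1\<close> has \<open>y\<close> in place of \<open>x\<close>, and \<open>C\<close> is
      the arc that starts with \<open>r2\<close> and wraps round through
      \<open>x # a1\<close>.\<close>
    define xs where "xs = (x # a1) @ (a2 @ y # r1) @ r2"
    have xs: "xs \<in> permutations_of_set X"
      using lists A C C' unfolding permutations_of_set_def xs_def by (auto simp: R_def)
    have dist: "distinct xs" "length xs = card X"
      using xs by (auto simp: permutations_of_set_def distinct_card)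
    have Ceq: "set (x # a1) \<union> set r2 = C" using lists C C' by (auto simp: R_def A)
    have lenC: "length (x # a1) + length r2 = l"
    proof -
      have "distinct ((x # a1) @ r2)" using xs by (auto simp: xs_def permutations_of_set_def)
      then have "length ((x # a1) @ r2) = card (set ((x # a1) @ r2))" by (metis distinct_card)
      then show ?thesis using Ceq C' by simp
    qed
    have lenA: "length (a1 @ a2) = l - 1"
    proof -
      have "distinct (a1 @ a2)" "set (a1 @ a2) = A" using lists by auto
      then show ?thesis using A by (metis distinct_card)
    qed
    have "arc xs l 0 = insert x A"
      using arc_append_middle[of "[]" "x # a1 @ a2" "y # r1 @ r2"] lists lenA l by (auto simp: xs_def)
    then have arc0: "arc xs l 0 \<in> N" using X0 A by simp
    have "arc xs l 1 = insert y A"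
      using arc_append_middle[of "[x]" "a1 @ a2 @ [y]" "r1 @ r2"] lists lenA l by (auto simp: xs_def)
    then have arc1: "arc xs l 1 \<notin> N" using Ay by simp
    have "length r2 < l" using lenC by simp
    from intersecting_arcs_consecutive[OF dist l inter cnt[OF xs] arc0 arc1 this]
    have "arc xs l (card X - length r2) \<in> N" by auto
    moreover have "card X - length r2 = length (x # a1) + length (a2 @ y # r1)"
      using dist(2) by (simp add: xs_def)
    ultimately show ?thesis
      using arc_append[of "x # a1" "a2 @ y # r1" r2] Ceq lenC by (simp add: xs_def)
  qed
  have "x \<in> E" if E: "E \<in> N" for E
  proof (rule ccontr)
    assume xE: "x \<notin> E"
    note E' = fin_in[OF subsetD[OF N E]]
    \<comment> \<open>\<open>2 * l < card X\<close> leaves \<open>l - 1\<close> points outside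
      \<open>x\<close>, \<open>y\<close> and \<open>E\<close>; with \<open>x\<close> they form a
      member disjoint from \<open>E\<close>.\<close>
    have "card (insert x (insert y E)) \<le> l + 2" using E' by (simp add: card_insert_if)
    moreover have "card (X - insert x (insert y E)) = card X - card (insert x (insert y E))"
      using E' A fin by (intro card_Diff_subset) auto
    ultimately have "l - 1 \<le> card (X - insert x (insert y E))" using l by linarith
    then obtain D where D: "D \<subseteq> X - insert x (insert y E)" "card D = l - 1" "finite D"
      by (meson obtain_subset_with_card_n)
    moreover from this have "card (insert x D) = l" using l by (subst card_insert_disjoint) auto
    ultimately have "insert x D \<in> nsets X l" using A by (auto simp: nsets_def)
    then have "insert x D \<in> N" using D A by (intro star) auto
    from inter[OF this E] show False using D xE by auto
  qed
  then show ?thesis using A by blast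
qed

section \<open>Wise-intersecting families\<close>

lemma exists_nset_between:
  assumes "finite C" "A \<subseteq> C" "card A \<le> r" "r \<le> card C"
  obtains B where "A \<subseteq> B" "B \<subseteq> C" "B \<in> nsets C r"
proof -
  obtain B where "A \<subseteq> B" "B \<subseteq> C" "card B = r" using exists_subset_between[of A r C] assms by blast
  moreover have "finite B" using \<open>B \<subseteq> C\<close> assms(1) by (rule finite_subset)
  ultimately show ?thesis using that by (simp add: nsets_def)
qed

lemma card_star:
  assumes "finite X" "x \<in> X" "0 < k"
  shows "card {A\<in>nsets X k. x \<in> A} = (card X - 1) choose (k - 1)"
proof -
  have "{A\<in>nsets X k. x \<in> A} = insert x ` nsets (X - {x}) (k - 1)"
  proof (intro equalityI subsetI)
    fix A assume "A \<in> {A\<in>nsets X k. x \<in> A}"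
    then have "A - {x} \<in> nsets (X - {x}) (k - 1)" "A = insert x (A - {x})" by (auto simp: nsets_def)
    then show "A \<in> insert x ` nsets (X - {x}) (k - 1)" by blast
  next
    fix A assume "A \<in> insert x ` nsets (X - {x}) (k - 1)"
    then obtain B where "A = insert x B" "B \<in> nsets (X - {x}) (k - 1)" by blast
    moreover from this have "card A = Suc (k - 1)"
      unfolding nsets_def by (simp, subst card_insert_disjoint) auto
    ultimately show "A \<in> {A\<in>nsets X k. x \<in> A}" using assms by (auto simp: nsets_def)
  qed
  moreover have "inj_on (insert x) (nsets (X - {x}) (k - 1))"
    by (rule inj_onI) (auto simp: nsets_def)
  ultimately show ?thesis using assms by (simp add: card_image)
qed

lemma complete_star_if_card_ge:
  assumes "finite X" "x \<in> X" "0 < k" "F \<subseteq> nsets X k" "\<And>A. A \<in> F \<Longrightarrow> x \<in> A"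
    and "(card X - 1) choose (k - 1) \<le> card F"
  shows "complete_star X k F"
proof -
  have "F = {A\<in>nsets X k. x \<in> A}"
  proof (rule card_seteq)
    show "finite {A\<in>nsets X k. x \<in> A}" using assms(1) by (simp add: finite_imp_finite_nsets)
    show "F \<subseteq> {A\<in>nsets X k. x \<in> A}" using assms(4,5) by blast
    show "card {A\<in>nsets X k. x \<in> A} \<le> card F" using card_star assms(1-3,6) by metis
  qed
  then show ?thesis unfolding complete_star_def using assms(2) by blast
qed

locale wise_intersecting =
  fixes X :: "'a set" and k d :: nat and F :: "'a set set"
  assumes finX: "finite X" and k: "0 < k" "k < card X" and dn: "card X \<le> d * (card X - k)"
    and F: "F \<subseteq> nsets X k"
    and inter: "\<And>\<C>. \<C> \<subseteq> F \<Longrightarrow> \<C> \<noteq> {} \<Longrightarrow> card \<C> \<le> d \<Longrightarrow> \<Inter>\<C> \<noteq> {}"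
begin

text \<open>Complements turn a common point into a failure to cover, and an upper bound on
  \<open>F\<close> into a lower bound on \<open>N\<close>.\<close>

definition N :: "'a set set" where
  "N = {D\<in>nsets X (card X - k). X - D \<notin> F}"

lemma compl: "A \<in> nsets X k \<Longrightarrow> X - A \<in> nsets X (card X - k)"
  using finX by (auto simp: nsets_def card_Diff_subset)

sublocale no_cover X "card X - k" d N
proof
  fix \<W> assume W: "\<W> \<subseteq> nsets X (card X - k) - N" "card \<W> \<le> d"
  show "\<Union>\<W> \<noteq> X"
  proof
    assume cover: "\<Union>\<W> = X"
    let ?C = "(\<lambda>D. X - D) ` \<W>"
    have "finite \<W>" using W finX by (meson finite_Diff finite_imp_finite_nsets finite_subset)
    then have "card ?C \<le> d" using W(2) card_image_le[of \<W> "\<lambda>D. X - D"] by linarith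
    moreover have "?C \<subseteq> F" using W by (auto simp: N_def)
    moreover have "?C \<noteq> {}" using cover k by auto
    ultimately have "\<Inter>?C \<noteq> {}" using inter by blast
    then obtain x where "\<And>D. D \<in> \<W> \<Longrightarrow> x \<in> X - D" by blast
    then show False using cover \<open>?C \<noteq> {}\<close> by blast
  qed
qed (use finX k dn in \<open>auto simp: N_def\<close>)

lemma card_F_N: "card F + card N = card X choose k"
proof -
  let ?c = "\<lambda>A. X - A"
  have "nsets X (card X - k) = ?c ` F \<union> N"
  proof (intro equalityI subsetI)
    fix D assume D: "D \<in> nsets X (card X - k)"
    then have "X - (X - D) = D" by (auto simp: nsets_def)
    then show "D \<in> ?c ` F \<union> N" using D unfolding N_def by (auto intro: image_eqI[of _ _ "X - D"])
  qed (use F compl in \<open>auto simp: N_def\<close>)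
  moreover have "?c ` F \<inter> N = {}"
    using F by (auto simp: N_def nsets_def double_diff)
  moreover have "inj_on ?c F"
    using F by (intro inj_on_inverseI[of _ ?c]) (auto simp: nsets_def double_diff)
  moreover have "finite F" "finite N"
    using F N finX by (meson finite_imp_finite_nsets finite_subset)+
  ultimately have "card (nsets X (card X - k)) = card F + card N"
    by (simp add: card_Un_disjoint card_image)
  then show ?thesis using k by (simp add: binomial_symmetric[symmetric])
qed

lemma choose_split:
  "((card X - 1) choose (k - 1)) + ((card X - 1) choose (card X - k - 1)) = card X choose k"
proof -
  have "(card X - 1) choose (card X - k - 1) = (card X - 1) choose k"
    using k by (subst binomial_symmetric) auto
  then show ?thesis using k choose_reduce_nat[of "card X" k] by simp
qed

lemma card_le: "card F \<le> (card X - 1) choose (k - 1)"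
  using card_ge card_F_N choose_split by linarith

lemma not_in_F: "A \<in> nsets X k \<Longrightarrow> A \<notin> F \<Longrightarrow> X - A \<in> N"
  using compl by (auto simp: N_def nsets_def double_diff)

context
  assumes eq: "card F = (card X - 1) choose (k - 1)"
begin

lemma card_N_eq: "card N = (card X - 1) choose (card X - k - 1)"
  using card_F_N choose_split eq by linarith

text \<open>Otherwise the complements of \<open>A\<close> and \<open>B\<close> would be disjoint
  members of the intersecting family \<open>N\<close>.\<close>

lemma complement_cases:
  assumes "card X \<le> 2 * k" and A: "A \<in> nsets X k" "B \<in> nsets X k" "A \<union> B = X"
  shows "A \<in> F \<or> B \<in> F"
proof (rule ccontr)
  assume "\<not> ?thesis"
  then have "(X - A) \<inter> (X - B) \<noteq> {}"
    using assms by (intro N_intersecting[OF card_N_eq] not_in_F) auto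
  then show False using A by blast
qed

text \<open>Here \<open>N\<close> is extremal intersecting with \<open>2 * l < card X\<close>, so
  its members share a point \<open>x\<close>. The complement of a \<open>k\<close>-set with
  \<open>x\<close> misses \<open>x\<close>, hence is not in \<open>N\<close>.\<close>

lemma star_if_card_eq:
  assumes "card X < 2 * k"
  shows "complete_star X k F"
proof -
  have half: "2 * (card X - k) < card X" using assms k by linarith
  obtain x where x: "x \<in> X" "\<And>D. D \<in> N \<Longrightarrow> x \<in> D"
    using intersecting_arcs_star[OF fin l(1) half N] N_intersecting[OF card_N_eq] arc_count_eq[OF card_N_eq] half
    by (meson less_imp_le)
  let ?S = "{A\<in>nsets X k. x \<in> A}"
  have "?S = F"
  proof (rule card_subset_eq)
    show "finite F" using F finX by (meson finite_imp_finite_nsets finite_subset)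
    show "?S \<subseteq> F" using x not_in_F by blast
    show "card ?S = card F" using card_star[OF finX x(1) k(1)] eq by simp
  qed
  then show ?thesis unfolding complete_star_def using x(1) by blast
qed

end

end

text \<open>The case \<open>d = 2\<close> of the cyclic argument, applied later to traces on a fixed
  member.\<close>

lemma EKR:
  assumes "finite X" "0 < k" "2 * k \<le> card X" "F \<subseteq> nsets X k"
    and inter: "\<And>A B. A \<in> F \<Longrightarrow> B \<in> F \<Longrightarrow> A \<inter> B \<noteq> {}"
  shows "card F \<le> (card X - 1) choose (k - 1)"
proof -
  interpret wise_intersecting X k 2 F
  proof
    fix \<C> assume C: "\<C> \<subseteq> F" "\<C> \<noteq> {}" "card \<C> \<le> 2"
    have "finite \<C>" using C assms by (meson finite_imp_finite_nsets finite_subset)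
    then have "card \<C> \<noteq> 0" using C by simp
    then have "card \<C> = 1 \<or> card \<C> = 2" using C(3) by linarith
    then obtain A B where "\<C> = {A, B}" by (metis card_1_singletonE card_2_iff insert_absorb2)
    then show "\<Inter>\<C> \<noteq> {}" using C inter[of A B] by simp
  qed (use assms in auto)
  show ?thesis by (rule card_le)
qed

text \<open>Let \<open>A \<inter> B\<close> be smallest and suppose \<open>E\<close> misses a point
  of it. A \<open>k\<close>-set \<open>C\<close> between \<open>A \<inter> B\<close> and
  \<open>A \<inter> B \<union> (X - E)\<close> is in \<open>F\<close>, since its complement misses
  \<open>A \<inter> B\<close>; but \<open>C \<inter> E\<close> is smaller than
  \<open>A \<inter> B\<close>.\<close>

lemma half_star:
  assumes fin: "finite X" and k: "card X = 2 * k" "0 < k" and F: "F \<subseteq> nsets X k" "F \<noteq> {}"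
    and inter: "\<And>A B C. A \<in> F \<Longrightarrow> B \<in> F \<Longrightarrow> C \<in> F \<Longrightarrow> A \<inter> B \<inter> C \<noteq> {}"
    and compl: "\<And>A. A \<in> nsets X k \<Longrightarrow> A \<in> F \<or> X - A \<in> F"
  shows "\<exists>x\<in>X. \<forall>A\<in>F. x \<in> A"
proof -
  have fin_in: "finite A" "A \<subseteq> X" "card A = k" if "A \<in> F" for A using that F by (auto simp: nsets_def)
  obtain A0 where A0: "A0 \<in> F" using F by blast
  obtain P where P: "P \<in> F \<times> F" "\<And>Q. Q \<in> F \<times> F \<Longrightarrow> card (fst P \<inter> snd P) \<le> card (fst Q \<inter> snd Q)"
    using ex_has_least_nat[of "\<lambda>P. P \<in> F \<times> F" "(A0, A0)" "\<lambda>P. card (fst P \<inter> snd P)"] A0 by auto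
  obtain A B where AB: "A \<in> F" "B \<in> F" and min: "\<And>C E. C \<in> F \<Longrightarrow> E \<in> F \<Longrightarrow> card (A \<inter> B) \<le> card (C \<inter> E)"
    using P by (cases P) force
  obtain x where x: "x \<in> A \<inter> B" using inter[OF AB AB(2)] by blast
  have "x \<in> E" if E: "E \<in> F" for E
  proof (rule ccontr)
    assume xE: "x \<notin> E"
    let ?I = "A \<inter> B"
    have "card (X - E) = k" using fin_in[OF E] k fin by (simp add: card_Diff_subset)
    then have "k \<le> card (?I \<union> (X - E))" by (metis card_mono fin fin_in(1)[OF AB(1)] finite_Diff finite_Int finite_Un sup_ge2)
    moreover have "card ?I \<le> k" using fin_in[OF AB(1)] by (metis Int_lower1 card_mono)
    moreover have "finite (?I \<union> (X - E))" using fin fin_in[OF AB(1)] by simp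
    ultimately obtain C where C: "?I \<subseteq> C" "C \<in> nsets (?I \<union> (X - E)) k"
      by (metis exists_nset_between sup_ge1)
    have "C \<in> nsets X k" using C fin_in[OF AB(1)] by (auto simp: nsets_def)
    then have "C \<in> F" using compl[of C] inter[OF AB, of "X - C"] C(1) by blast
    have "C \<inter> E \<subset> ?I" using C x xE by (auto simp: nsets_def)
    then have "card (C \<inter> E) < card ?I" using fin_in[OF AB(1)] by (intro psubset_card_mono) auto
    with min[OF \<open>C \<in> F\<close> E] show False by simp
  qed
  then show ?thesis using x fin_in[OF AB(1)] by blast
qed

lemma le_choose: "0 < j \<Longrightarrow> j < m \<Longrightarrow> m \<le> m choose j"
proof (induction m arbitrary: j)
  case (Suc m)
  then obtain i where j: "j = Suc i" by (cases j) auto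
  have pos: "0 < m choose i" using Suc.prems j by simp
  show ?case
  proof (cases "j = m")
    case True
    then show ?thesis using Suc.prems by (simp add: binomial_symmetric[of m "Suc m"])
  next
    case False
    then have "m \<le> m choose j" using Suc by auto
    then show ?thesis using pos unfolding j binomial_Suc_Suc by linarith
  qed
qed simp

text \<open>If \<open>S - {x}\<close> lies in another member, that member is a neighbour with trace
  \<open>S - {x}\<close>, different for different \<open>x\<close>. So at most
  \<open>d - 2 \<le> k - 2\<close> points are not in \<open>own S\<close>, and the
  \<open>(k - 1)\<close>-sets given by \<open>own\<close> are all distinct.\<close>

lemma card_lt_if_few_neighbours:
  assumes fin: "finite X" and d: "3 \<le> d" "d \<le> k" and n: "2 * k \<le> card X" and F: "F \<subseteq> nsets X k"
    and few: "\<And>S. S \<in> F \<Longrightarrow> card {A\<in>F - {S}. k \<le> 2 * card (A \<inter> S)} \<le> d - 2"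
  shows "card F < (card X - 1) choose (k - 1)"
proof -
  have fin_in: "finite A" "A \<subseteq> X" "card A = k" if "A \<in> F" for A using that F by (auto simp: nsets_def)
  have finF: "finite F" using F fin by (meson finite_imp_finite_nsets finite_subset)
  define own where "own S = {x\<in>S. \<forall>A\<in>F. S - {x} \<subseteq> A \<longrightarrow> A = S}" for S
  have own_ge: "2 \<le> card (own S)" if S: "S \<in> F" for S
  proof -
    let ?N = "{A\<in>F - {S}. k \<le> 2 * card (A \<inter> S)}"
    have "\<exists>A. A \<in> ?N \<and> A \<inter> S = S - {x}" if x: "x \<in> S - own S" for x
    proof -
      obtain A where A: "A \<in> F" "S - {x} \<subseteq> A" "A \<noteq> S" using x unfolding own_def by blast
      have "x \<notin> A"
      proof
        assume "x \<in> A"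
        then have "S \<subseteq> A" using A by auto
        then show False using card_subset_eq[of A S] fin_in[OF S] fin_in[OF A(1)] A(3) by metis
      qed
      then have "A \<inter> S = S - {x}" using A by auto
      moreover have "card (S - {x}) = k - 1" using x fin_in[OF S] by simp
      ultimately show ?thesis using A d by auto
    qed
    then have "\<forall>x\<in>S - own S. \<exists>A. A \<in> ?N \<and> A \<inter> S = S - {x}" by blast
    from bchoice[OF this] obtain f where f: "\<forall>x\<in>S - own S. f x \<in> ?N \<and> f x \<inter> S = S - {x}" by blast
    have "inj_on f (S - own S)"
    proof (rule inj_onI)
      fix x y assume xy: "x \<in> S - own S" "y \<in> S - own S" "f x = f y"
      then have "S - {x} = S - {y}" using f by metis
      then show "x = y" using xy by blast
    qed
    then have "card (S - own S) \<le> card ?N"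
      using f finF by (intro card_inj_on_le[of f]) auto
    also have "\<dots> \<le> d - 2" by (rule few[OF S])
    finally have "card (S - own S) \<le> d - 2" .
    moreover have "card (S - own S) = k - card (own S)"
      using fin_in[OF S] by (subst card_Diff_subset) (auto simp: own_def)
    ultimately show ?thesis using d by linarith
  qed
  let ?P = "SIGMA S:F. own S"
  have "inj_on (\<lambda>(S, x). S - {x}) ?P"
  proof (intro inj_onI, clarify, intro conjI)
    fix S x S' x' assume *: "S \<in> F" "x \<in> own S" "S' \<in> F" "x' \<in> own S'" "S - {x} = S' - {x'}"
    then show SS': "S = S'" unfolding own_def by blast
    have "x \<in> S" "x' \<in> S" using * SS' unfolding own_def by blast+
    then show "x = x'" using *(5) SS' by blast
  qed
  moreover have "(\<lambda>(S, x). S - {x}) ` ?P \<subseteq> nsets X (k - 1)"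
    using fin_in by (auto simp: own_def nsets_def)
  ultimately have "card ?P \<le> card (nsets X (k - 1))"
    using fin by (intro card_inj_on_le finite_imp_finite_nsets) 
  moreover have "card ?P = (\<Sum>S\<in>F. card (own S))"
    using finF fin_in by (intro card_SigmaI) (auto simp: own_def)
  moreover have "(\<Sum>S\<in>F. 2) \<le> (\<Sum>S\<in>F. card (own S))" by (intro sum_mono own_ge)
  ultimately have le: "2 * card F \<le> card X choose (k - 1)" by simp
  \<comment> \<open>The two binomials have ratio \<open>card X / (card X - k + 1)\<close>, which is
    below \<open>2\<close> because \<open>2 * k \<le> card X\<close>.\<close>
  have "(card X - (k - 1)) * (card X choose (k - 1)) = card X * ((card X - 1) choose (k - 1))"
    by (rule binomial_absorb_comp)
  also have "\<dots> < (card X - (k - 1)) * (2 * ((card X - 1) choose (k - 1)))"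
  proof -
    have "card X < 2 * (card X - (k - 1))" using n d by linarith
    moreover have "0 < (card X - 1) choose (k - 1)" using n d by simp
    ultimately show ?thesis by (metis mult.assoc mult.commute mult_less_mono1)
  qed
  finally have "card X choose (k - 1) < 2 * ((card X - 1) choose (k - 1))" by (rule mult_less_cancel1[THEN iffD1, THEN conjunct2])
  with le show ?thesis by linarith
qed

section \<open>Counting relative to a member\<close>

lemma finite_shadow: "finite H \<Longrightarrow> (\<And>A. A \<in> H \<Longrightarrow> finite A) \<Longrightarrow> finite (shadow H j)"
  unfolding shadow_def by (auto intro: finite_imp_finite_nsets)

lemma card_supersets:
  assumes "finite R" "Z \<in> nsets R i" "i \<le> j"
  shows "card {Y\<in>nsets R j. Z \<subseteq> Y} = (card R - i) choose (j - i)"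
proof -
  have Z: "Z \<subseteq> R" "finite Z" "card Z = i" using assms by (auto simp: nsets_def)
  have "{Y\<in>nsets R j. Z \<subseteq> Y} = (\<lambda>W. Z \<union> W) ` nsets (R - Z) (j - i)"
  proof (intro equalityI subsetI)
    fix Y assume "Y \<in> {Y\<in>nsets R j. Z \<subseteq> Y}"
    then have "Y - Z \<in> nsets (R - Z) (j - i)" "Y = Z \<union> (Y - Z)"
      using Z by (auto simp: nsets_def card_Diff_subset)
    then show "Y \<in> (\<lambda>W. Z \<union> W) ` nsets (R - Z) (j - i)" by blast
  next
    fix Y assume "Y \<in> (\<lambda>W. Z \<union> W) ` nsets (R - Z) (j - i)"
    then obtain W where W: "Y = Z \<union> W" "W \<subseteq> R - Z" "finite W" "card W = j - i" by (auto simp: nsets_def)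
    then have "card Y = i + (j - i)" using Z by (subst W(1), subst card_Un_disjoint) auto
    then show "Y \<in> {Y\<in>nsets R j. Z \<subseteq> Y}" using W Z assms by (auto simp: nsets_def)
  qed
  moreover have "inj_on (\<lambda>W. Z \<union> W) (nsets (R - Z) (j - i))"
    by (rule inj_onI) (auto simp: nsets_def)
  ultimately show ?thesis using assms Z by (simp add: card_image card_Diff_subset)
qed

text \<open>The hypothesis \<open>local\<close> is the case \<open>d = 3\<close> of the cluster condition, required only
  for the triples containing the fixed member \<open>S\<close>. Members are counted by their part \<open>Z\<close>
  outside \<open>S\<close>.\<close>

locale local_three_cluster =
  fixes X :: "'a set" and k :: nat and F :: "'a set set" and S :: "'a set"
  assumes finX: "finite X" and k3: "3 \<le> k" and n2k: "2 * k \<le> card X" and F: "F \<subseteq> nsets X k"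
    and S: "S \<in> F"
    and local: "\<And>A B. A \<in> F \<Longrightarrow> B \<in> F \<Longrightarrow> A \<noteq> B \<Longrightarrow> A \<noteq> S \<Longrightarrow> B \<noteq> S \<Longrightarrow>
      card (S \<union> A \<union> B) \<le> 2 * k \<Longrightarrow> S \<inter> A \<inter> B \<noteq> {}"
begin

definition R where "R = X - S"
definition H where "H = {A\<in>F. A \<inter> S = {}}"
definition E where "E Z = {A\<in>F. A - S = Z}"
text \<open>The only candidates for outside parts of members meeting \<open>S\<close>, by
  \<open>E_shadow\<close>.\<close>

definition U where "U j = nsets R j - shadow H j"
definition G where "G j = (\<Sum>Z\<in>nsets R j. card (E Z))"

lemma F_D: "A \<in> F \<Longrightarrow> finite A \<and> A \<subseteq> X \<and> card A = k"
  using F by (auto simp: nsets_def)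

lemma S_D: "finite S" "S \<subseteq> X" "card S = k" "S \<noteq> {}"
  using F_D[OF S] k3 by auto

lemma finF: "finite F"
  using F finX by (meson finite_imp_finite_nsets finite_subset)

lemma finR: "finite R"
  using finX by (simp add: R_def)

lemma card_R: "card R = card X - k"
  using finX S_D by (simp add: R_def card_Diff_subset)

lemma k_le_R: "k \<le> card R"
  using card_R n2k by simp

lemma finE: "finite (E Z)"
  using finF by (simp add: E_def)

lemma finU: "finite (U j)"
  using finR by (simp add: U_def finite_imp_finite_nsets)

lemma nsets_R_D: "Z \<in> nsets R j \<Longrightarrow> finite Z \<and> Z \<subseteq> X \<and> Z \<inter> S = {} \<and> card Z = j"
  by (auto simp: nsets_def R_def)

lemma E_D:
  assumes "A \<in> E Z" "Z \<in> nsets R j"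
  shows "A \<in> F" "A = (A \<inter> S) \<union> Z" "A \<inter> S \<in> nsets S (k - j)" "0 < j \<Longrightarrow> A \<noteq> S"
proof -
  show A: "A \<in> F" "A = (A \<inter> S) \<union> Z" using assms by (auto simp: E_def)
  have "card (A - S) = j" using assms by (auto simp: E_def nsets_def)
  then have "card (A \<inter> S) = k - j"
    using F_D[OF A(1)] card_Diff_subset_Int[of A S] by (metis card_Int_Diff diff_add_inverse2 finite_Int)
  then show "A \<inter> S \<in> nsets S (k - j)" using F_D[OF A(1)] by (auto simp: nsets_def)
  show "A \<noteq> S" if "0 < j" using \<open>card (A - S) = j\<close> that by auto
qed

lemma trace_inj: "inj_on (\<lambda>A. A \<inter> S) (E Z)"
  by (rule inj_onI) (auto simp: E_def)

lemma card_trace: "card ((\<lambda>A. A \<inter> S) ` E Z) = card (E Z)"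
  by (rule card_image[OF trace_inj])

lemma card_S_Un: "finite Y \<Longrightarrow> card (S \<union> Y) \<le> k + card Y"
  using card_Un_le[of S Y] S_D by simp

text \<open>With \<open>A\<close> in \<open>H\<close> above \<open>Z\<close> and \<open>B\<close> in
  \<open>E Z\<close>, the union of \<open>S\<close>, \<open>A\<close>, \<open>B\<close> is
  \<open>S \<union> A\<close>, of size at most \<open>2 * k\<close>, although \<open>A\<close>
  misses \<open>S\<close>.\<close>

lemma E_shadow:
  assumes Z: "Z \<in> shadow H j" "Z \<in> nsets R j" and j: "0 < j" "j < k"
  shows "E Z = {}"
proof (rule ccontr)
  assume "E Z \<noteq> {}"
  then obtain B where B: "B \<in> E Z" by blast
  obtain A where A: "A \<in> F" "A \<inter> S = {}" "Z \<subseteq> A" using Z by (auto simp: shadow_def H_def nsets_def)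
  note B' = E_D[OF B Z(2)]
  have "B \<inter> S \<noteq> {}" using B'(3) j by (auto simp: nsets_def)
  then have "A \<noteq> B" "A \<noteq> S" using A S_D by auto
  moreover have "S \<union> A \<union> B = S \<union> A" using B'(2) A by blast
  then have "card (S \<union> A \<union> B) \<le> 2 * k" using card_S_Un[of A] F_D[OF A(1)] by simp
  ultimately have "S \<inter> A \<inter> B \<noteq> {}" using local A B' j by blast
  then show False using A by blast
qed

text \<open>Two members of \<open>E Z\<close> lie with \<open>S\<close> inside
  \<open>S \<union> Z\<close>, so their traces intersect; \<open>EKR\<close> applies on
  \<open>S\<close> because the traces have at most \<open>k / 2\<close> points.\<close>

lemma card_E_le:
  assumes Z: "Z \<in> nsets R j" and j: "0 < j" "j < k" "k \<le> 2 * j"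
  shows "card (E Z) \<le> (k - 1) choose j"
proof -
  let ?T = "(\<lambda>A. A \<inter> S) ` E Z"
  have "card ?T \<le> (card S - 1) choose ((k - j) - 1)"
  proof (rule EKR)
    show "finite S" "0 < k - j" "2 * (k - j) \<le> card S" using S_D j by auto
    show "?T \<subseteq> nsets S (k - j)" using E_D[OF _ Z] by auto
  next
    fix T T' assume "T \<in> ?T" "T' \<in> ?T"
    then obtain A B where AB: "A \<in> E Z" "B \<in> E Z" "T = A \<inter> S" "T' = B \<inter> S" by blast
    note A' = E_D[OF AB(1) Z] and B' = E_D[OF AB(2) Z]
    show "T \<inter> T' \<noteq> {}"
    proof (cases "A = B")
      case True
      then show ?thesis using A'(3) AB j by (auto simp: nsets_def)
    next
      case False
      have "card (S \<union> A \<union> B) \<le> card (S \<union> Z)"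
        using A'(2) B'(2) S_D nsets_R_D[OF Z] by (intro card_mono) auto
      also have "\<dots> \<le> 2 * k" using card_S_Un[of Z] nsets_R_D[OF Z] j by simp
      finally have "S \<inter> A \<inter> B \<noteq> {}" using local[of A B] A' B' False j by blast
      then show ?thesis using AB by blast
    qed
  qed
  also have "(card S - 1) choose ((k - j) - 1) = (k - 1) choose j"
    using j S_D by (subst binomial_symmetric) auto
  finally show ?thesis unfolding card_trace .
qed

text \<open>Traces for \<open>Z\<close> and complements in \<open>S\<close> of traces for
  \<open>Z'\<close> are disjoint families of \<open>(k - j)\<close>-sets: complementary traces would
  give a small union without a common point.\<close>

lemma card_E_add_le:
  assumes Z: "Z \<in> nsets R j" and Z': "Z' \<in> nsets R (k - j)" and j: "0 < j" "j < k"
  shows "card (E Z) + card (E Z') \<le> k choose j"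
proof -
  let ?T = "(\<lambda>A. A \<inter> S) ` E Z" and ?T' = "(\<lambda>A. S - A \<inter> S) ` E Z'"
  have "inj_on (\<lambda>A. S - A \<inter> S) (E Z')" by (rule inj_onI) (auto simp: E_def)
  then have card': "card ?T' = card (E Z')" by (rule card_image)
  have "?T \<inter> ?T' = {}"
  proof (rule ccontr)
    assume "?T \<inter> ?T' \<noteq> {}"
    then obtain A B where AB: "A \<in> E Z" "B \<in> E Z'" "A \<inter> S = S - B \<inter> S" by blast
    note A' = E_D[OF AB(1) Z] and B' = E_D[OF AB(2) Z']
    have "A \<noteq> B" using AB S_D by blast
    have "card (S \<union> A \<union> B) \<le> card (S \<union> (Z \<union> Z'))"
      using A'(2) B'(2) S_D nsets_R_D[OF Z] nsets_R_D[OF Z'] by (intro card_mono) auto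
    also have "\<dots> \<le> k + card (Z \<union> Z')" using card_S_Un nsets_R_D[OF Z] nsets_R_D[OF Z'] by simp
    also have "\<dots> \<le> 2 * k" using card_Un_le[of Z Z'] nsets_R_D[OF Z] nsets_R_D[OF Z'] j by simp
    finally have "S \<inter> A \<inter> B \<noteq> {}" using local[of A B] A' B' \<open>A \<noteq> B\<close> j by auto
    then show False using AB by blast
  qed
  moreover have "?T \<union> ?T' \<subseteq> nsets S (k - j)"
  proof -
    have "S - A \<inter> S \<in> nsets S (k - j)" if "A \<in> E Z'" for A
    proof -
      have "A \<inter> S \<in> nsets S j" using E_D(3)[OF that Z'] j by simp
      then show ?thesis using S_D by (auto simp: nsets_def card_Diff_subset)
    qed
    then show ?thesis using E_D(3)[OF _ Z] by blast
  qed
  moreover have "finite ?T" "finite ?T'" "finite (nsets S (k - j))"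
    using finE S_D by (auto intro: finite_imp_finite_nsets)
  ultimately have "card ?T + card ?T' \<le> card (nsets S (k - j))"
    by (metis card_Un_disjoint card_mono)
  then show ?thesis
    unfolding card_trace card' using S_D j by (simp add: binomial_symmetric[symmetric])
qed

text \<open>The complement of a shadow is closed under taking supersets, so its larger levels are
  at least as big.\<close>

lemma card_U_mono:
  assumes j: "0 < j" "j < k" "k \<le> 2 * j"
  shows "card (U (k - j)) \<le> card (U j)"
proof -
  let ?i = "k - j"
  have ij: "?i \<le> j" using j by simp
  \<comment> \<open>Count inclusions between the two levels: each smaller set has at least
    \<open>j choose ?i\<close> supersets, as \<open>card R \<ge> ?i + j\<close>, and each larger set
    has at most that many subsets.\<close>
  have "(\<Sum>Z'\<in>U ?i. card {Z\<in>U j. Z' \<subseteq> Z}) = (\<Sum>Z'\<in>U ?i. \<Sum>Z\<in>{Z\<in>U j. Z' \<subseteq> Z}. 1)" by simp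
  also have "\<dots> = (\<Sum>Z\<in>U j. \<Sum>Z'\<in>{Z'\<in>U ?i. Z' \<subseteq> Z}. 1)"
    using finU by (rule sum.swap_restrict[OF _ finU])
  finally have swap: "(\<Sum>Z'\<in>U ?i. card {Z\<in>U j. Z' \<subseteq> Z}) = (\<Sum>Z\<in>U j. card {Z'\<in>U ?i. Z' \<subseteq> Z})" by simp
  have "card (U ?i) * (j choose ?i) = (\<Sum>Z'\<in>U ?i. j choose ?i)" by simp
  also have "\<dots> \<le> (\<Sum>Z'\<in>U ?i. card {Z\<in>U j. Z' \<subseteq> Z})"
  proof (rule sum_mono)
    fix Z' assume Z': "Z' \<in> U ?i"
    then have Z'R: "Z' \<in> nsets R ?i" "Z' \<notin> shadow H ?i" by (auto simp: U_def)
    have "{Z\<in>U j. Z' \<subseteq> Z} = {Z\<in>nsets R j. Z' \<subseteq> Z}"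
    proof -
      have "Z \<notin> shadow H j" if "Z' \<subseteq> Z" for Z
        using Z'R that unfolding shadow_def nsets_def by blast
      then show ?thesis by (auto simp: U_def)
    qed
    then have "card {Z\<in>U j. Z' \<subseteq> Z} = (card R - ?i) choose (j - ?i)"
      using card_supersets[OF finR Z'R(1) ij] by simp
    moreover have "j choose ?i = j choose (j - ?i)" using ij by (rule binomial_symmetric)
    moreover have "j choose (j - ?i) \<le> (card R - ?i) choose (j - ?i)"
      using k_le_R j by (intro binomial_right_mono) linarith
    ultimately show "j choose ?i \<le> card {Z\<in>U j. Z' \<subseteq> Z}" by simp
  qed
  also have "\<dots> \<le> (\<Sum>Z\<in>U j. j choose ?i)"
    unfolding swap
  proof (rule sum_mono)
    fix Z assume "Z \<in> U j"
    then have Z: "finite Z" "card Z = j" by (auto simp: U_def nsets_def)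
    have "card {Z'\<in>U ?i. Z' \<subseteq> Z} \<le> card (nsets Z ?i)"
      using Z by (intro card_mono finite_imp_finite_nsets) (auto simp: U_def nsets_def)
    then show "card {Z'\<in>U ?i. Z' \<subseteq> Z} \<le> j choose ?i" using Z by simp
  qed
  finally show ?thesis using ij by simp
qed

section \<open>Comparing the levels \<open>j\<close> and \<open>k - j\<close> with those of a
  star\<close>

lemma G_U: "0 < j \<Longrightarrow> j < k \<Longrightarrow> G j = (\<Sum>Z\<in>U j. card (E Z))"
  unfolding G_def U_def using finR E_shadow
  by (intro sum.mono_neutral_right) (auto intro: finite_imp_finite_nsets)

text \<open>The level total if each \<open>Z\<close> in \<open>U j\<close> had as many members as in
  a star centred at a point of \<open>S\<close>.\<close>

definition W where "W j = ((k - 1) choose j) * card (U j)"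

lemma choose_k: "0 < j \<Longrightarrow> j < k \<Longrightarrow> k choose j = ((k - 1) choose j) + ((k - 1) choose (k - j))"
proof -
  assume j: "0 < j" "j < k"
  then have "(k - 1) choose (k - j) = (k - 1) choose (j - 1)" by (subst binomial_symmetric) auto
  then show ?thesis using choose_reduce_nat[of k j] j by simp
qed

lemma G_pair_le:
  assumes j: "0 < j" "j < k" "k \<le> 2 * j"
  shows "G j + G (k - j) \<le> W j + W (k - j)"
proof -
  let ?a = "(k - 1) choose j" and ?b = "(k - 1) choose (k - j)" and ?u = "card (U j)" and ?v = "card (U (k - j))"
  have vu: "?v \<le> ?u" by (rule card_U_mono[OF j])
  have Gj: "G j = (\<Sum>Z\<in>U j. card (E Z))" and Gi: "G (k - j) = (\<Sum>Z\<in>U (k - j). card (E Z))"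
    using G_U j by auto
  show ?thesis
  proof (cases "U j = {}")
    case True
    then show ?thesis using vu Gj Gi finU by simp
  next
    case False
    define t where "t = Max ((\<lambda>Z. card (E Z)) ` U j)"
    have "t \<in> (\<lambda>Z. card (E Z)) ` U j" unfolding t_def using False finU by (intro Max_in) auto
    then obtain Z where Z: "Z \<in> nsets R j" "card (E Z) = t" by (auto simp: U_def)
    have ta: "t \<le> ?a" using card_E_le[OF Z(1) j] Z(2) by simp
    have "card (E Z') \<le> t" if "Z' \<in> U j" for Z' unfolding t_def using finU that by (intro Max_ge) auto
    then have "G j \<le> ?u * t" unfolding Gj using sum_bounded_above[of "U j" "\<lambda>Z. card (E Z)" t] by simp
    moreover have "card (E Z') \<le> ?a + ?b - t" if "Z' \<in> U (k - j)" for Z'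
      using card_E_add_le[OF Z(1) _ j(1,2), of Z'] that Z(2) choose_k[OF j(1,2)] unfolding U_def by auto linarith
    then have "G (k - j) \<le> ?v * (?a + ?b - t)"
      unfolding Gi using sum_bounded_above[of "U (k - j)" "\<lambda>Z. card (E Z)" "?a + ?b - t"] by simp
    moreover obtain s where s: "?a = t + s" using ta le_iff_add by blast
    moreover obtain w where w: "?u = ?v + w" using vu le_iff_add by blast
    \<comment> \<open>The largest group size \<open>t\<close> on level \<open>j\<close> limits
      groups on level \<open>k - j\<close> to \<open>?a + ?b - t\<close>. The bound then falls short
      of the claim by \<open>(?u - ?v) * (?a - t) = w * s\<close>.\<close>
    ultimately show ?thesis unfolding W_def s w by (simp add: algebra_simps)
  qed
qed

lemma G_pair_le': "0 < j \<Longrightarrow> j < k \<Longrightarrow> G j + G (k - j) \<le> W j + W (k - j)"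
proof (cases "k \<le> 2 * j")
  case False
  assume "0 < j" "j < k"
  then have "G (k - j) + G (k - (k - j)) \<le> W (k - j) + W (k - (k - j))"
    using False by (intro G_pair_le) auto
  moreover have "k - (k - j) = j" using \<open>j < k\<close> by simp
  ultimately show ?thesis by simp
qed (rule G_pair_le)

lemma sum_reflect: "(\<Sum>j\<in>{1..<k}. f (k - j)) = (\<Sum>j\<in>{1..<k}. f j)" for f :: "nat \<Rightarrow> nat"
  by (rule sum.reindex_bij_witness[of _ "\<lambda>j. k - j" "\<lambda>j. k - j"]) auto

lemma sum_pair: "2 * (\<Sum>j\<in>{1..<k}. f j) = (\<Sum>j\<in>{1..<k}. f j + f (k - j))" for f :: "nat \<Rightarrow> nat"
  unfolding sum.distrib sum_reflect by simp

lemma sum_G_le: "(\<Sum>j\<in>{1..<k}. G j) \<le> (\<Sum>j\<in>{1..<k}. W j)"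
proof -
  have "(\<Sum>j\<in>{1..<k}. G j + G (k - j)) \<le> (\<Sum>j\<in>{1..<k}. W j + W (k - j))"
    by (rule sum_mono) (use G_pair_le' in auto)
  then show ?thesis unfolding sum_pair[symmetric] by simp
qed

lemma card_F: "card F = 1 + (\<Sum>j\<in>{1..<k}. G j) + card H"
proof -
  have "card F = card (\<Union>j\<in>{..k}. {A\<in>F. card (A - S) = j})"
  proof -
    have "card (A - S) \<le> k" if "A \<in> F" for A using F_D[OF that] by (metis Diff_subset card_mono)
    then have "F = (\<Union>j\<in>{..k}. {A\<in>F. card (A - S) = j})" by auto
    then show ?thesis by simp
  qed
  also have "\<dots> = (\<Sum>j\<in>{..k}. card {A\<in>F. card (A - S) = j})"
    using finF by (intro card_UN_disjoint) auto
  also have "{..k} = insert 0 (insert k {1..<k})" using k3 by auto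
  also have "(\<Sum>j\<in>\<dots>. card {A\<in>F. card (A - S) = j}) =
      card {A\<in>F. card (A - S) = 0} + (card {A\<in>F. card (A - S) = k} + (\<Sum>j\<in>{1..<k}. card {A\<in>F. card (A - S) = j}))"
    using k3 by simp
  also have "{A\<in>F. card (A - S) = 0} = {S}"
  proof -
    have "A = S" if "A \<in> F" "card (A - S) = 0" for A
      using that F_D[OF that(1)] S_D card_subset_eq[of S A] by auto
    then show ?thesis using S by auto
  qed
  also have "{A\<in>F. card (A - S) = k} = H"
  proof -
    have "card (A - S) = k \<longleftrightarrow> A \<inter> S = {}" if "A \<in> F" for A
    proof
      assume "card (A - S) = k"
      then have "A - S = A" using F_D[OF that] card_subset_eq[of A "A - S"] by auto
      then show "A \<inter> S = {}" by blast
    next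
      assume "A \<inter> S = {}"
      then show "card (A - S) = k" using F_D[OF that] by (simp add: Diff_triv)
    qed
    then show ?thesis by (auto simp: H_def)
  qed
  also have "(\<Sum>j\<in>{1..<k}. card {A\<in>F. card (A - S) = j}) = (\<Sum>j\<in>{1..<k}. G j)"
  proof (rule sum.cong[OF refl])
    fix j
    have "A - S \<in> nsets R j \<longleftrightarrow> card (A - S) = j" if "A \<in> F" for A
      using F_D[OF that] by (auto simp: nsets_def R_def)
    then have "{A\<in>F. card (A - S) = j} = (\<Union>Z\<in>nsets R j. E Z)"
      unfolding E_def by blast
    moreover have "card (\<Union>Z\<in>nsets R j. E Z) = G j"
      unfolding G_def
    proof (rule card_UN_disjoint)
      show "finite (nsets R j)" using finR by (rule finite_imp_finite_nsets)
      show "\<forall>Z\<in>nsets R j. finite (E Z)" using finE by blast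
      show "\<forall>Z\<in>nsets R j. \<forall>Z'\<in>nsets R j. Z \<noteq> Z' \<longrightarrow> E Z \<inter> E Z' = {}" unfolding E_def by blast
    qed
    ultimately show "card {A\<in>F. card (A - S) = j} = G j" by simp
  qed
  finally show ?thesis by simp
qed

lemma card_U_shadow: "card (U j) + card (shadow H j) = card R choose j"
proof -
  have sub: "shadow H j \<subseteq> nsets R j"
    using F_D by (fastforce simp: shadow_def H_def nsets_def R_def)
  have fin: "finite (nsets R j)" using finR by (rule finite_imp_finite_nsets)
  show ?thesis
    unfolding U_def using card_Diff_subset[OF finite_subset[OF sub fin] sub] card_mono[OF fin sub] by simp
qed

text \<open>Vandermonde for \<open>R\<close> and \<open>k - 1\<close> further points, each level
  split into \<open>U j\<close> and the shadow. The shadow terms are the loss that has to pay for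
  \<open>H\<close>.\<close>

lemma choose_eq_sum:
  "(card X - 1) choose (k - 1) =
    1 + (\<Sum>j\<in>{1..<k}. W j) + (\<Sum>j\<in>{1..<k}. ((k - 1) choose j) * card (shadow H j))"
proof -
  have "(card X - 1) choose (k - 1) = (card R + (k - 1)) choose (k - 1)"
    using card_R n2k k3 by simp
  also have "\<dots> = (\<Sum>j\<le>k - 1. (card R choose j) * ((k - 1) choose (k - 1 - j)))"
    by (rule vandermonde[symmetric])
  also have "\<dots> = (\<Sum>j\<le>k - 1. ((k - 1) choose j) * (card R choose j))"
  proof (rule sum.cong[OF refl])
    fix j assume "j \<in> {..k - 1}"
    then show "(card R choose j) * ((k - 1) choose (k - 1 - j)) = ((k - 1) choose j) * (card R choose j)"
      using binomial_symmetric[of j "k - 1"] by simp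
  qed
  also have "{..k - 1} = insert 0 {1..<k}" using k3 by auto
  also have "(\<Sum>j\<in>\<dots>. ((k - 1) choose j) * (card R choose j)) = 1 + (\<Sum>j\<in>{1..<k}. ((k - 1) choose j) * (card R choose j))"
    by simp
  finally show ?thesis
    by (simp add: W_def card_U_shadow[symmetric] distrib_left sum.distrib)
qed

text \<open>Level \<open>k - 1\<close> already pays for \<open>H\<close>; level
  \<open>k - 2\<close>, positive because \<open>k \<ge> 3\<close>, makes the inequality
  strict.\<close>

lemma sum_shadow_gt:
  assumes "H \<noteq> {}" "card H \<le> card (shadow H (k - 1))"
  shows "card H < (\<Sum>j\<in>{1..<k}. ((k - 1) choose j) * card (shadow H j))"
proof -
  let ?f = "\<lambda>j. ((k - 1) choose j) * card (shadow H j)"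
  obtain A where A: "A \<in> H" using assms by blast
  then have "finite A" "card A = k" using F_D by (auto simp: H_def)
  then obtain B where "B \<subseteq> A" "card B = k - 2" "finite B" by (metis diff_le_self obtain_subset_with_card_n)
  then have "B \<in> shadow H (k - 2)" using A by (auto simp: shadow_def nsets_def)
  moreover have "finite (shadow H (k - 2))"
    using finF F_D by (intro finite_shadow) (auto simp: H_def)
  ultimately have "0 < card (shadow H (k - 2))" by (auto simp: card_gt_0_iff)
  then have "0 < ?f (k - 2)" using k3 by simp
  moreover have "?f (k - 1) = card (shadow H (k - 1))" by simp
  ultimately have "card H < ?f (k - 1) + ?f (k - 2)" using assms(2) by linarith
  also have "\<dots> = (\<Sum>j\<in>{k - 1, k - 2}. ?f j)" using k3 by simp
  also have "\<dots> \<le> (\<Sum>j\<in>{1..<k}. ?f j)" using k3 by (intro sum_mono2) auto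
  finally show ?thesis .
qed

context
  assumes H_shadow: "card H \<le> card (shadow H (k - 1))"
begin

lemma card_F_less: "H \<noteq> {} \<Longrightarrow> card F < (card X - 1) choose (k - 1)"
  using card_F choose_eq_sum sum_G_le sum_shadow_gt H_shadow by linarith

lemma card_F_le: "card F \<le> (card X - 1) choose (k - 1)"
proof (cases "H = {}")
  case True
  then show ?thesis using card_F choose_eq_sum sum_G_le by simp
qed (use card_F_less in auto)

section \<open>Equality on more than \<open>2 * k\<close> points\<close>

context
  assumes eq: "card F = (card X - 1) choose (k - 1)" and n2k': "2 * k < card X"
begin

lemma H_empty: "H = {}"
  using card_F_less eq by auto

text \<open>Equality overall forces equality in each pair of levels, and a
  \<open>(k - 1)\<close>-set without extension makes the pair \<open>k - 1\<close>, \<open>1\<close>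
  strict.\<close>

lemma card_E_eq_1:
  assumes Z: "Z \<in> nsets R (k - 1)"
  shows "card (E Z) = 1"
proof (rule ccontr)
  assume "card (E Z) \<noteq> 1"
  let ?m = "card R" and ?c = "card R choose (k - 1)"
  have k1: "0 < k - 1" "k - 1 < k" "k \<le> 2 * (k - 1)" using k3 by auto
  have le1: "card (E Y) \<le> 1" if "Y \<in> nsets R (k - 1)" for Y using card_E_le[OF that k1] by simp
  have Z0: "card (E Z) = 0" using le1[OF Z] \<open>card (E Z) \<noteq> 1\<close> by linarith
  have fin: "finite (nsets R (k - 1))" using finR by (rule finite_imp_finite_nsets)
  have U: "U j = nsets R j" for j using H_empty by (simp add: U_def shadow_def)
  have W: "W (k - 1) + W 1 = ?c + (k - 1) * ?m" using finR by (simp add: W_def U)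
  have pair: "k - (k - 1) = 1" using k3 by simp
  have lt: "?m < ?c"
  proof -
    have m: "k < ?m" using card_R n2k' by simp
    have "?m * ((?m - 1) choose (k - 2)) = (k - 1) * ?c"
      using times_binomial_minus1_eq[of "k - 1" ?m] k3 by (simp add: numeral_2_eq_2)
    moreover have "(?m - 1) * ?m \<le> ((?m - 1) choose (k - 2)) * ?m"
      using k3 m by (intro mult_le_mono1 le_choose) auto
    moreover have "(k - 1) * ?m < (?m - 1) * ?m"
      using k3 m by (intro mult_less_mono1) auto
    ultimately have "(k - 1) * ?m < (k - 1) * ?c" by (simp only: mult.commute[of ?m])
    then show ?thesis by simp
  qed
  \<comment> \<open>If some \<open>Y\<close> has an extension, singleton groups stay within
    \<open>k - 1\<close> and the loss at \<open>Z\<close> decides. If none has, singleton groups may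
    reach \<open>k\<close>, but this gains only \<open>?m\<close>, less than the \<open>?c\<close>
    lost.\<close>
  have "G (k - 1) + G 1 < W (k - 1) + W 1"
  proof (cases "\<exists>Y\<in>nsets R (k - 1). card (E Y) = 1")
    case True
    then obtain Y where Y: "Y \<in> nsets R (k - 1)" "card (E Y) = 1" by blast
    have "card (E y) \<le> k - 1" if "y \<in> nsets R 1" for y
      using card_E_add_le[OF Y(1) _ k1(1,2), of y] that Y(2) pair k3 binomial_symmetric[of 1 k] by simp
    then have "G 1 \<le> ?m * (k - 1)"
      unfolding G_def using sum_bounded_above[of "nsets R 1" "\<lambda>Z. card (E Z)" "k - 1"] finR by simp
    moreover have "G (k - 1) < ?c"
    proof -
      have "G (k - 1) < (\<Sum>Y\<in>nsets R (k - 1). 1)"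
        unfolding G_def using fin le1 Z Z0 by (intro sum_strict_mono_ex1) auto
      then show ?thesis using finR by simp
    qed
    ultimately show ?thesis unfolding W by (simp add: mult.commute)
  next
    case False
    then have "card (E Y) = 0" if "Y \<in> nsets R (k - 1)" for Y using le1[OF that] that by fastforce
    then have "G (k - 1) = 0" by (simp add: G_def)
    moreover have "card (E y) \<le> k" if "y \<in> nsets R 1" for y
      using card_E_add_le[OF Z _ k1(1,2), of y] that Z0 pair k3 binomial_symmetric[of 1 k] by simp
    then have "G 1 \<le> ?m * k"
      unfolding G_def using sum_bounded_above[of "nsets R 1" "\<lambda>Z. card (E Z)" k] finR by simp
    moreover have "?m * k = ?m + (k - 1) * ?m" using k3 by (cases k) auto
    ultimately show ?thesis unfolding W using lt by linarith
  qed
  then have "(\<Sum>j\<in>{1..<k}. G j + G (k - j)) < (\<Sum>j\<in>{1..<k}. W j + W (k - j))"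
    using G_pair_le' k3 pair by (intro sum_strict_mono_ex1 bexI[of _ "k - 1"]) auto
  then have "(\<Sum>j\<in>{1..<k}. G j) < (\<Sum>j\<in>{1..<k}. W j)" unfolding sum_pair[symmetric] by simp
  then show False using card_F choose_eq_sum eq H_empty by simp
qed

lemma E_insert: "Z \<in> nsets R (k - 1) \<Longrightarrow> \<exists>x\<in>S. insert x Z \<in> F"
proof -
  assume Z: "Z \<in> nsets R (k - 1)"
  obtain A where A: "A \<in> E Z" using card_E_eq_1[OF Z] by (metis card_1_singletonE singletonI)
  note A' = E_D[OF A Z]
  have "card (A \<inter> S) = 1" using A'(3) k3 by (simp add: nsets_def)
  then obtain x where "A \<inter> S = {x}" by (rule card_1_singletonE)
  then show ?thesis using A'(1,2) by auto
qed

lemma star_if_card_eq: "complete_star X k F"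
proof -
  obtain Z0 where Z0: "Z0 \<in> nsets R (k - 1)"
  proof -
    have "k - 1 \<le> card R" using k_le_R by simp
    then show ?thesis using that by (metis ex_in_conv finR nsets_eq_empty_iff not_less)
  qed
  obtain x where x: "x \<in> S" "insert x Z0 \<in> F" using E_insert[OF Z0] by blast
  have all: "insert x Z \<in> F" if "Z \<in> nsets R (k - 1)" for Z
    using that
  proof (induction "card (Z - Z0)" arbitrary: Z)
    case 0
    have "Z \<subseteq> Z0" using 0 nsets_R_D[OF 0(2)] by auto
    then have "Z = Z0" using nsets_R_D[OF 0(2)] nsets_R_D[OF Z0] card_subset_eq[of Z0 Z] by auto
    then show ?case using x by simp
  next
    case (Suc r)
    note ZD = nsets_R_D[OF Suc.prems] and Z0D = nsets_R_D[OF Z0]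
    have "Z - Z0 \<noteq> {}" using Suc.hyps(2) by (metis card.empty nat.distinct(1))
    then obtain z where z: "z \<in> Z" "z \<notin> Z0" by blast
    have "\<not> Z0 \<subseteq> Z" using z ZD Z0D card_subset_eq[of Z Z0] by auto
    then obtain z0 where z0: "z0 \<in> Z0" "z0 \<notin> Z" by blast
    let ?Z1 = "insert z0 (Z - {z})"
    have "card ?Z1 = k - 1" using z z0 ZD k3 by simp
    then have Z1: "?Z1 \<in> nsets R (k - 1)"
      using Suc.prems Z0 z0 by (auto simp: nsets_def)
    have "?Z1 - Z0 = (Z - Z0) - {z}" using z0 z by auto
    then have "card (?Z1 - Z0) = r" using Suc.hyps(2) z ZD by simp
    then have B: "insert x ?Z1 \<in> F" using Suc.hyps(1)[OF _ Z1] by simp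
    \<comment> \<open>\<open>Z\<close> and \<open>?Z1\<close> differ by one exchange, so with
      \<open>S\<close> both extended sets lie in \<open>S \<union> insert z0 Z\<close>, of size at
      most \<open>2 * k\<close>; a common point in \<open>S\<close> must be both \<open>x\<close>
      and \<open>y\<close>.\<close>
    obtain y where y: "y \<in> S" "insert y Z \<in> F" using E_insert[OF Suc.prems] by blast
    show ?case
    proof (cases "y = x")
      case False
      have ne: "insert y Z \<noteq> insert x ?Z1" "insert y Z \<noteq> S" "insert x ?Z1 \<noteq> S"
        using z z0 x y Z0D ZD by auto
      have "S \<union> insert y Z \<union> insert x ?Z1 = S \<union> insert z0 Z" using x y by auto
      moreover have "card (S \<union> insert z0 Z) \<le> 2 * k"
        using card_S_Un[of "insert z0 Z"] ZD z0 k3 by simp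
      ultimately have "S \<inter> insert y Z \<inter> insert x ?Z1 \<noteq> {}"
        using local[OF y(2) B] ne by simp
      then show ?thesis using False ZD Z0D z0 y x by auto
    qed (use y in simp)
  qed
  \<comment> \<open>As \<open>H\<close> is empty, \<open>A - S\<close> fits into a
    \<open>(k - 1)\<close>-set \<open>Z\<close>. Then \<open>S\<close>, \<open>A\<close> and
    \<open>insert x Z\<close> lie in \<open>S \<union> Z\<close>, and their common point can only be
    \<open>x\<close>.\<close>
  have "x \<in> A" if A: "A \<in> F" for A
  proof (rule ccontr)
    assume xA: "x \<notin> A"
    have AS: "A \<inter> S \<noteq> {}" using H_empty A by (auto simp: H_def)
    have "card (A - S) < card A" using AS F_D[OF A] by (intro psubset_card_mono) auto
    then have "card (A - S) \<le> k - 1" using F_D[OF A] by simp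
    moreover have "A - S \<subseteq> R" using F_D[OF A] by (auto simp: R_def)
    moreover have "k - 1 \<le> card R" using k_le_R by simp
    ultimately obtain Z where Z: "A - S \<subseteq> Z" "Z \<in> nsets R (k - 1)"
      using exists_nset_between[OF finR] by metis
    note ZD = nsets_R_D[OF Z(2)]
    have "card (S \<union> A \<union> insert x Z) \<le> card (S \<union> Z)"
      using Z(1) x S_D ZD by (intro card_mono) auto
    also have "\<dots> \<le> 2 * k" using card_S_Un[of Z] ZD by simp
    finally have "S \<inter> A \<inter> insert x Z \<noteq> {}"
      using xA x ZD k3 by (intro local A all[OF Z(2)]) auto
    then show False using xA ZD by auto
  qed
  then show ?thesis
    using finX x S_D k3 F eq by (intro complete_star_if_card_ge[of X x]) auto
qed

end

end

end

section \<open>Intersecting clusters\<close>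

locale cluster_intersecting =
  fixes X :: "'a set" and k d :: nat and F :: "'a set set"
  assumes finX: "finite X" and d3: "3 \<le> d" and dk: "d \<le> k" and kn: "k < card X"
    and dn: "card X \<le> d * (card X - k)" and F: "F \<subseteq> nsets X k"
    and clus: "\<And>\<C>. \<C> \<subseteq> F \<Longrightarrow> card \<C> = d \<Longrightarrow> 2 * card (\<Union>\<C>) \<le> (d + 1) * k \<Longrightarrow> \<Inter>\<C> \<noteq> {}"
begin

lemma finF: "finite F"
  using F finX by (meson finite_imp_finite_nsets finite_subset)

lemma F_D: "A \<in> F \<Longrightarrow> finite A \<and> A \<subseteq> X \<and> card A = k"
  using F by (auto simp: nsets_def)

lemma choose_pos: "0 < (card X - 1) choose (k - 1)"
  using kn by simp

text \<open>Covers families too small to be padded to \<open>d\<close> members: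
  \<open>d \<le> k \<le> card X - 1\<close>, which is at most the binomial.\<close>

lemma card_lt_if_small: "card F < d \<Longrightarrow> card F < (card X - 1) choose (k - 1)"
  using le_choose[of "k - 1" "card X - 1"] kn dk d3 by linarith

text \<open>Any \<open>d\<close> members form a cluster, since their union has at most
  \<open>2 * k \<le> (d + 1) * k / 2\<close> points; fewer members are padded to
  \<open>d\<close>.\<close>

lemma bound_small_ground:
  assumes n: "card X \<le> 2 * k"
  shows "card F \<le> (card X - 1) choose (k - 1) \<and>
    (card F = (card X - 1) choose (k - 1) \<longrightarrow> complete_star X k F)"
proof (cases "card F < d")
  case True
  then show ?thesis using card_lt_if_small by linarith
next
  case False
  interpret wise_intersecting X k d F
  proof
    fix \<C> assume C: "\<C> \<subseteq> F" "\<C> \<noteq> {}" "card \<C> \<le> d"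
    obtain \<D> where D: "\<C> \<subseteq> \<D>" "\<D> \<subseteq> F" "card \<D> = d"
      using exists_subset_between[OF C(3) _ C(1) finF] False by auto
    have "card (\<Union>\<D>) \<le> card X" using D(2) F_D finX by (intro card_mono) auto
    then have "2 * card (\<Union>\<D>) \<le> 4 * k" using n by linarith
    also have "\<dots> \<le> (d + 1) * k" using d3 by (intro mult_le_mono1) simp
    finally show "\<Inter>\<C> \<noteq> {}" using clus[OF D(2,3)] D(1) by blast
  qed (use finX kn dn F d3 dk in auto)
  have "complete_star X k F" if eq: "card F = (card X - 1) choose (k - 1)"
  proof (cases "card X = 2 * k")
    case True
    have "\<exists>x\<in>X. \<forall>A\<in>F. x \<in> A"
    proof (rule half_star[OF finX True])
      show "0 < k" "F \<subseteq> nsets X k" using dk d3 F by auto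
      show "F \<noteq> {}" using eq choose_pos by auto
    next
      fix A B C assume "A \<in> F" "B \<in> F" "C \<in> F"
      moreover have "card {A, B, C} \<le> d" using card_length[of "[A, B, C]"] d3 by simp
      ultimately show "A \<inter> B \<inter> C \<noteq> {}" using inter[of "{A, B, C}"] by (simp add: Int_assoc)
    next
      fix A assume A: "A \<in> nsets X k"
      moreover have "X - A \<in> nsets X k" using A True finX by (auto simp: nsets_def card_Diff_subset)
      moreover have "A \<union> (X - A) = X" using A by (auto simp: nsets_def)
      ultimately show "A \<in> F \<or> X - A \<in> F" using n by (intro complement_cases[OF eq])
    qed
    then show ?thesis using complete_star_if_card_ge[of X _ k F] finX F eq dk d3 by auto
  next
    case False
    then show ?thesis using star_if_card_eq[OF eq] n by simp
  qed
  then show ?thesis using card_le by blast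
qed

text \<open>Traces missing the \<open>d - 2\<close> points of \<open>D\<close> one at a time, together with the trace \<open>D\<close>,
  would give a cluster of \<open>d\<close> sets whose union has at most \<open>2k\<close> elements.\<close>

lemma missing_trace:
  assumes S: "S \<in> F"
  shows "\<exists>U. U \<subset> S \<and> (\<forall>A\<in>F. A \<inter> S \<noteq> U)"
proof (rule ccontr)
  assume "\<not> ?thesis"
  then have "\<forall>U. \<exists>A. U \<subset> S \<longrightarrow> A \<in> F \<and> A \<inter> S = U" by blast
  from choice[OF this] obtain f where f: "\<And>U. U \<subset> S \<Longrightarrow> f U \<in> F \<and> f U \<inter> S = U" by blast
  note S' = F_D[OF S]
  have "d - 2 \<le> card S" using S' dk by simp
  then obtain D where D: "D \<subseteq> S" "card D = d - 2" "finite D" by (rule obtain_subset_with_card_n)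
  let ?T = "insert D ((\<lambda>x. S - {x}) ` D)"
  have T: "U \<subset> S" if "U \<in> ?T" for U
    using that D S' dk d3 by auto
  have fT: "f U \<inter> S = U" if "U \<in> ?T" for U using f[OF T[OF that]] by (rule conjunct2)
  have fF: "f ` ?T \<subseteq> F" using f T by (intro image_subsetI) simp
  have D_notin: "D \<notin> (\<lambda>x. S - {x}) ` D" by auto
  have "inj_on (\<lambda>x. S - {x}) D" using D(1) by (intro inj_onI) blast
  then have card_T: "card ?T = d - 1" using D D_notin d3 by (simp add: card_image)
  have inj: "inj_on f ?T" by (rule inj_on_inverseI[of _ "\<lambda>A. A \<inter> S"]) (rule fT)
  have S_notin: "S \<notin> f ` ?T"
  proof
    assume "S \<in> f ` ?T"
    then obtain U where "U \<in> ?T" "S = f U" by (rule imageE)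
    with fT[of U] T[of U] show False by simp
  qed
  let ?C = "insert S (f ` ?T)"
  have sub: "?C \<subseteq> F" using S fF by simp
  have "card ?C = d" using card_image[OF inj] card_T S_notin D d3 by (simp del: image_insert add: card_insert_if)
  \<comment> \<open>\<open>S\<close> gives \<open>k\<close> points, \<open>f D\<close> adds
    \<open>k - (d - 2)\<close>, and each of the other \<open>d - 2\<close> sets adds one:
    \<open>2 * k\<close> in all.\<close>
  moreover have "2 * card (\<Union>?C) \<le> (d + 1) * k"
  proof -
    have union: "\<Union>?C \<subseteq> S \<union> (f D - S) \<union> (\<Union>x\<in>D. f (S - {x}) - S)" by blast
    have fin: "finite (f U)" if "U \<in> ?T" for U
      using F_D[of "f U"] f[OF T[OF that]] by blast
    have new: "card (f U - S) = k - card U" if "U \<in> ?T" for U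
      using card_Int_Diff[OF fin[OF that], of S] F_D[of "f U"] f[OF T[OF that]] by simp
    have "finite (f D)" "\<And>x. x \<in> D \<Longrightarrow> finite (f (S - {x}))" by (rule fin, simp)+
    then have "finite (S \<union> (f D - S) \<union> (\<Union>x\<in>D. f (S - {x}) - S))"
      using S' D(3) by simp
    from card_mono[OF this union]
    have "card (\<Union>?C) \<le> card (S \<union> (f D - S) \<union> (\<Union>x\<in>D. f (S - {x}) - S))" .
    also have "\<dots> \<le> card S + card (f D - S) + card (\<Union>x\<in>D. f (S - {x}) - S)"
      by (meson card_Un_le le_trans add_le_mono1)
    also have "card (\<Union>x\<in>D. f (S - {x}) - S) \<le> (\<Sum>x\<in>D. card (f (S - {x}) - S))"
      by (rule card_UN_le[OF D(3)])
    also have "\<dots> = (\<Sum>x\<in>D. 1)"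
    proof (rule sum.cong[OF refl])
      fix x assume "x \<in> D"
      then have "card (S - {x}) = k - 1" "S - {x} \<in> ?T" using D S' by auto
      then show "card (f (S - {x}) - S) = 1" using new[of "S - {x}"] dk d3 by simp
    qed
    also have "card (f D - S) = k - (d - 2)" using new[of D] D by simp
    finally have "card (\<Union>?C) \<le> 2 * k" using S' D dk by simp
    moreover have "4 * k \<le> (d + 1) * k" using d3 by (intro mult_le_mono1) simp
    ultimately show ?thesis by linarith
  qed
  ultimately have "\<Inter>?C \<noteq> {}" using clus[OF sub] by blast
  then obtain y where y: "y \<in> \<Inter>?C" by (metis ex_in_conv)
  have yU: "y \<in> U" if "U \<in> ?T" for U
  proof -
    have "y \<in> f U" using y that by (meson InterD imageI insertI2)
    moreover have "y \<in> S" using y by simp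
    ultimately have "y \<in> f U \<inter> S" by simp
    then show ?thesis unfolding fT[OF that] .
  qed
  \<comment> \<open>The trace \<open>D\<close> puts the common point \<open>y\<close> into
    \<open>D\<close>, but then \<open>S - {y}\<close> is one of the traces.\<close>
  have "y \<in> D" by (rule yU) simp
  then have "y \<in> S - {y}" by (intro yU) simp
  then show False by simp
qed

lemma shadow_ge: "H \<subseteq> F \<Longrightarrow> card H \<le> card (shadow H (k - 1))"
proof (rule card_le_card_shadow)
  assume H: "H \<subseteq> F"
  then show "finite H" using finF by (rule finite_subset)
  show "finite A \<and> card A = k" if "A \<in> H" for A using F_D[of A] H that by blast
  show "\<exists>U. U \<subset> S \<and> (\<forall>A\<in>H. A \<inter> S \<noteq> U)" if "S \<in> H" for S
    using missing_trace[of S] H that by (meson subsetD)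
qed

text \<open>Each neighbour of \<open>S\<close> contributes at most \<open>k / 2\<close> new elements, so neighbours can pad a
  triple with union of size \<open>2k\<close> to \<open>d\<close> sets with union of size \<open>(d + 1) k / 2\<close>.\<close>

lemma local_three_cluster_if_neighbours:
  assumes S: "S \<in> F" and many: "d - 1 \<le> card {A\<in>F - {S}. k \<le> 2 * card (A \<inter> S)}"
    and AB: "A \<in> F" "B \<in> F" "A \<noteq> B" "A \<noteq> S" "B \<noteq> S" and le: "card (S \<union> A \<union> B) \<le> 2 * k"
  shows "S \<inter> A \<inter> B \<noteq> {}"
proof -
  let ?N = "{A\<in>F - {S}. k \<le> 2 * card (A \<inter> S)}"
  have "card ?N - card {A, B} \<le> card (?N - {A, B})" by (rule diff_card_le_card_Diff) simp
  \<comment> \<open>\<open>A\<close> and \<open>B\<close> may themselves be neighbours of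
    \<open>S\<close>, which costs at most two of the \<open>d - 1\<close>.\<close>
  then have "d - 3 \<le> card (?N - {A, B})" using many AB by simp
  then obtain D where D: "D \<subseteq> ?N - {A, B}" "card D = d - 3" "finite D" by (rule obtain_subset_with_card_n)
  let ?C = "{S, A, B} \<union> D"
  have "card ?C = card {S, A, B} + card D" using D by (intro card_Un_disjoint) auto
  then have "card ?C = d" using AB D d3 by auto
  moreover have "?C \<subseteq> F" using S AB D by auto
  moreover have "2 * card (\<Union>?C) \<le> (d + 1) * k"
  proof -
    have "2 * card (C - S) \<le> k" if "C \<in> D" for C
    proof -
      have C: "C \<in> F" "k \<le> 2 * card (C \<inter> S)" using that D by auto
      then have "card C = card (C \<inter> S) + card (C - S)"
        using F_D by (metis card_Int_Diff)
      then show ?thesis using C F_D[OF C(1)] by simp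
    qed
    then have sum: "(\<Sum>C\<in>D. 2 * card (C - S)) \<le> (d - 3) * k"
      using sum_bounded_above[of D "\<lambda>C. 2 * card (C - S)" k] D by simp
    have "\<Union>?C = (S \<union> A \<union> B) \<union> (\<Union>C\<in>D. C - S)" by auto
    then have "card (\<Union>?C) \<le> card (S \<union> A \<union> B) + card (\<Union>C\<in>D. C - S)" by (metis card_Un_le)
    also have "card (\<Union>C\<in>D. C - S) \<le> (\<Sum>C\<in>D. card (C - S))" by (rule card_UN_le[OF D(3)])
    finally have "2 * card (\<Union>?C) \<le> 4 * k + (\<Sum>C\<in>D. 2 * card (C - S))"
      using le by (simp add: sum_distrib_left[symmetric])
    also have "\<dots> \<le> 4 * k + (d - 3) * k" using sum by simp
    also have "\<dots> = (d + 1) * k" using d3 by (simp add: add_mult_distrib[symmetric])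
    finally show ?thesis .
  qed
  ultimately have "\<Inter>?C \<noteq> {}" using clus by blast
  then show ?thesis by blast
qed

text \<open>The threshold fits both sides: \<open>d - 1\<close> neighbours suffice for padding, and
  at most \<open>d - 2\<close> leave each member two \<open>(k - 1)\<close>-subsets of its
  own.\<close>

lemma bound_large_ground:
  assumes n: "2 * k < card X"
  shows "card F \<le> (card X - 1) choose (k - 1) \<and>
    (card F = (card X - 1) choose (k - 1) \<longrightarrow> complete_star X k F)"
proof (cases "\<forall>S\<in>F. card {A\<in>F - {S}. k \<le> 2 * card (A \<inter> S)} \<le> d - 2")
  case True
  then have "card F < (card X - 1) choose (k - 1)"
    using n by (intro card_lt_if_few_neighbours[OF finX d3 dk _ F]) auto
  then show ?thesis by simp
next
  case False
  then obtain S where S: "S \<in> F" "d - 1 \<le> card {A\<in>F - {S}. k \<le> 2 * card (A \<inter> S)}" by force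
  interpret local_three_cluster X k F S
    by unfold_locales (use finX d3 dk n F S local_three_cluster_if_neighbours[OF S] in auto)
  have "card H \<le> card (shadow H (k - 1))" by (rule shadow_ge) (auto simp: H_def)
  from card_F_le[OF this] star_if_card_eq[OF this] n show ?thesis by blast
qed

end

section \<open>From real bounds to inequalities between natural numbers\<close>

theorem theorem2p2:
  fixes k d n :: nat and \<F> :: "nat set set"
  assumes "k \<ge> d" and "d \<ge> 3"
    and "real n \<ge> real d * real k / (real d - 1)"
    and "\<F> \<subseteq> nsets {1..n} k"
    and "\<And>\<C>. \<C> \<subseteq> \<F> \<Longrightarrow> is_cluster d ((real d + 1) / 2) k \<C> \<Longrightarrow> \<Inter>\<C> \<noteq> {}"
  shows "card \<F> \<le> (n - 1) choose (k - 1) \<and>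
    (card \<F> = (n - 1) choose (k - 1) \<longrightarrow> complete_star {1..n} k \<F>)"
proof -
  \<comment> \<open>Clearing the denominator \<open>d - 1 > 0\<close> gives
    \<open>d * k + n \<le> n * d\<close>, which also excludes \<open>n \<le> k\<close>.\<close>
  have "real d * real k \<le> real n * (real d - 1)"
    using assms(2,3) by (simp add: pos_divide_le_eq)
  also have "real n * (real d - 1) = real (n * (d - 1))" using assms(2) by (simp add: of_nat_diff)
  finally have "d * k \<le> n * (d - 1)" by (simp only: of_nat_mult[symmetric] of_nat_le_iff)
  moreover have "n * d = n * (d - 1) + n" using assms(2) by (cases d) auto
  ultimately have dn: "d * k + n \<le> n * d" by linarith
  have kn: "k < n"
  proof (rule ccontr)
    assume "\<not> k < n"
    then have "n * d \<le> d * k" by (simp add: mult.commute)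
    then have "n = 0" using dn by linarith
    then show False using dn assms(1,2) by simp
  qed
  interpret cluster_intersecting "{1..n}" k d \<F>
  proof
    show "card {1..n} \<le> d * (card {1..n} - k)"
      using dn kn by (simp add: diff_mult_distrib2 mult.commute)
  next
    fix \<C> assume C: "\<C> \<subseteq> \<F>" "card \<C> = d" "2 * card (\<Union>\<C>) \<le> (d + 1) * k"
    have "finite \<C>" using C(2) assms(2) by (intro card_ge_0_finite) simp
    then have "\<C> \<in> nsets (nsets UNIV k) d"
      using C(1,2) assms(4) nsets_mono[of "{1..n}" UNIV k] by (auto simp: nsets_def)
    moreover have "real (2 * card (\<Union>\<C>)) \<le> real ((d + 1) * k)" using C(3) by (simp only: of_nat_le_iff)
    then have "real (card (\<Union>\<C>)) \<le> (real d + 1) / 2 * real k" by (simp add: algebra_simps)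
    ultimately show "\<Inter>\<C> \<noteq> {}" using assms(5)[OF C(1)] by (simp add: is_cluster_def)
  qed (use assms kn in auto)
  show ?thesis
    using bound_small_ground bound_large_ground by (cases "n \<le> 2 * k") auto
qed

end
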